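(* Let $\mathcal{X}\in\mathcal{H}_*^{m\times p}$ be a quasitubal tensor, let $r\le\min(m,p)$ be a non-negative integer and let $\rho=(\rho_k)_{k\in\mathbb{Z}}$ be a sequence of integers with $0\le\rho_k\leq\min(m,p)$. Let $[\mathcal{X}]_r$ and $[\mathcal{X}]_\rho$ be the q-rank-$r$ truncation and the multi-rank-$\rho$ truncation of $\mathcal{X}$ under $\star_F$. Then for any $\mathcal{Y}\in\mathcal{H}_*^{m\times p}$: (1) if the multi-rank $\varphi$ of $\mathcal{Y}$ satisfies $\varphi_k\leq\rho_k$ for all $k\in\mathbb{Z}$, then $\|\mathcal{X}-[\mathcal{X}]_\rho\|_{\mathrm{op}}\leq\|\mathcal{X}-\mathcal{Y}\|_{\mathrm{op}}$; and (2) if the q-rank of $\mathcal{Y}$ is at most $r$, then $\|\mathcal{X}-[\mathcal{X}]_r\|_{\mathrm{op}}\leq\|\mathcal{X}-\mathcal{Y}\|_{\mathrm{op}}$.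
   Context: $\mathbb{F}$ is $\mathbb{R}$ or $\mathbb{C}$; $m,p$ are positive integers. $\mathcal{H}$ is a separable infinite-dimensional Hilbert space over $\mathbb{F}$ (inner product linear in the first argument) with a fixed orthonormal basis $F=\{\phi^{(j)}\}_{j\in\mathbb{Z}}$. For $x\in\mathcal{H}$ put $\widehat{x}_j=\langle x,\phi^{(j)}\rangle_{\mathcal{H}}$, and define $x\star_F y=\sum_{j}\widehat{x}_j\widehat{y}_j\phi^{(j)}\in\mathcal{H}$. A map $T:\mathcal{H}\to\mathcal{H}$ is $\mathcal{H}$-linear if $T(a\star_F x+b\star_F y)=a\star_F T(x)+b\star_F T(y)$ for all $a,b,x,y\in\mathcal{H}$. A quasitube is a bounded $\mathcal{H}$-linear operator on $\mathcal{H}$; $\mathcal{H}_*$ is the set of quasitubes, a commutative unital C*-algebra over $\mathbb{F}$ under composition (also written $\star_F$), Hilbert space adjoint and operator norm, with unit $e$. The map $\pi(q)=(\langle q(\phi^{(j)}),\phi^{(j)}\rangle_{\mathcal{H}})_{j\in\mathbb{Z}}$ is an isometric *-isomorphism of $\mathcal{H}_*$ onto $\ell_\infty(\mathbb{Z})$. For $a,b\in\mathcal{H}_*$, $a\geq_{\mathcal{H}_*}b$ means that $a-b$ is self-adjoint with spectrum (scalars $\lambda$ such that $a-b-\lambda e$ is not invertible in $\mathcal{H}_*$) contained in $[0,\infty)$; equivalently all entries of $\pi(a-b)$ are non-negative reals. An $m\times p$ quasitubal tensor is a matrix $\mathcal{X}=(x_{ij})\in\mathcal{H}_*^{m\times p}$;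 for $k\in\mathbb{Z}$, $\widehat{\mathcal{X}}_{:,:,k}\in\mathbb{F}^{m\times p}$ is the matrix with entries $\pi(x_{ij})_k$. $\mathcal{X}\star_F\mathcal{Y}$ has slices $\widehat{\mathcal{X}}_{:,:,k}\widehat{\mathcal{Y}}_{:,:,k}$; $\mathcal{X}^*$ has slices $(\widehat{\mathcal{X}}_{:,:,k})^{\mathrm{H}}$ (conjugate transpose); the identity tensor $\mathcal{I}$ has $e$ on the diagonal and $0$ elsewhere; $\mathcal{U}$ (square) is $\star_F$-unitary if $\mathcal{U}^*\star_F\mathcal{U}=\mathcal{U}\star_F\mathcal{U}^*=\mathcal{I}$; $\mathcal{S}$ is f-diagonal if all $\widehat{\mathcal{S}}_{:,:,k}$ are (rectangular) diagonal. Operator norm: $\|\mathcal{B}\|_{\mathrm{op}}=\sup\{\|\mathcal{B}\star_F X\|_{\mathcal{H}}: X\in\mathcal{H}^p,\ \|X\|_{\mathcal{H}}=1\}$ for $\mathcal{B}\in\mathcal{H}_*^{m\times p}$, where $\|X\|_{\mathcal{H}}^2=\sum_j\|x_j\|_{\mathcal{H}}^2$ and $(\mathcal{B}\star_F X)_i=\sum_j b_{ij}(x_j)$. A q-SVD of $\mathcal{X}$ is a factorization $\mathcal{X}=\mathcal{U}\star_F\mathcal{S}\star_F\mathcal{V}^*$ with $\mathcal{U}\in\mathcal{H}_*^{m\times m}$, $\mathcal{V}\in\mathcal{H}_*^{p\times p}$ $\star_F$-unitary and $\mathcal{S}\in\mathcal{H}_*^{m\times p}$ f-diagonal with diagonal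 entries (the singular quasitubes) $s_1\geq_{\mathcal{H}_*}\cdots\geq_{\mathcal{H}_*}s_{\min(m,p)}\geq_{\mathcal{H}_*}0$; one always exists. The q-rank of $\mathcal{X}$ is the number of non-zero singular quasitubes; the multi-rank of $\mathcal{X}$ is the sequence $(\operatorname{rank}\widehat{\mathcal{X}}_{:,:,k})_{k\in\mathbb{Z}}$. Given a q-SVD of $\mathcal{X}$, the multi-rank-$\rho$ truncation $[\mathcal{X}]_\rho$ is the quasitubal tensor whose $k$-th transformed slice is $\widehat{\mathcal{U}}_{:,1:\rho_k,k}\,\widehat{\mathcal{S}}_{1:\rho_k,1:\rho_k,k}\,(\widehat{\mathcal{V}}_{:,1:\rho_k,k})^{\mathrm{H}}$ for all $k\in\mathbb{Z}$, and the q-rank-$r$ truncation is $[\mathcal{X}]_r=\mathcal{U}_{:,1:r}\star_F\mathcal{S}_{1:r,1:r}\star_F(\mathcal{V}_{:,1:r})^*$. *)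

theory Defs
  imports
    "HOL-Analysis.Infinite_Sum"
    "Jordan_Normal_Form.Schur_Decomposition"
    "Jordan_Normal_Form.DL_Rank"
    "Jordan_Normal_Form.DL_Submatrix"
begin

text \<open>
  The scalar field, to be instantiated by the reals or the complex numbers.  A field with a
  multiplicative norm over the reals is isometric to one of these two, and the axiom below
  pins \<open>conjugate\<close> down to the usual conjugation.
\<close>

class rc_scalar = real_normed_field + conjugatable_field +
  assumes mult_conjugate: "x * conjugate x = (norm x)\<^sup>2 *\<^sub>R 1"

instance real :: rc_scalar
  by standard (simp add: power2_eq_square)

instance complex :: rc_scalar
  by standard (simp only: conjugate_complex_def complex_norm_square of_real_def [symmetric])


section \<open>The Hilbert space and its fixed orthonormal basis\<close>

record ('f, 'h) based_space =
  scl :: "'f \<Rightarrow> 'h \<Rightarrow> 'h"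
  ip :: "'h \<Rightarrow> 'h \<Rightarrow> 'f"
  bas :: "int \<Rightarrow> 'h"

text \<open>
  Completeness is part of the class \<open>banach\<close>.  Separability and infinite dimension follow from
  the orthonormal basis indexed by the integers.
\<close>

locale based_hilbert_space =
  vector_space "scl H" for H :: "('f::rc_scalar, 'h::banach) based_space" +
  assumes scl_of_real: "scl H (of_real c) x = c *\<^sub>R x"
    and ip_add_left: "ip H (x + y) z = ip H x z + ip H y z"
    and ip_scl_left: "ip H (scl H a x) z = a * ip H x z"
    and ip_commute: "ip H y x = conjugate (ip H x y)"
    and ip_self: "ip H x x = of_real ((norm x)\<^sup>2)"
    and bas_orthonormal: "ip H (bas H i) (bas H j) = (if i = j then 1 else 0)"
    and bas_total: "closure (span (range (bas H))) = UNIV"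

definition coord :: "('f, 'h) based_space \<Rightarrow> 'h \<Rightarrow> int \<Rightarrow> 'f" where
  "coord H x j = ip H x (bas H j)"

definition star :: "('f::rc_scalar, 'h::banach) based_space \<Rightarrow> 'h \<Rightarrow> 'h \<Rightarrow> 'h" where
  "star H x y = (\<Sum>\<^sub>\<infinity>j. scl H (coord H x j * coord H y j) (bas H j))"


section \<open>Quasitubes\<close>

definition H_linear :: "('f::rc_scalar, 'h::banach) based_space \<Rightarrow> ('h \<Rightarrow> 'h) \<Rightarrow> bool" where
  "H_linear H T \<longleftrightarrow>
    (\<forall>a b x y. T (star H a x + star H b y) = star H a (T x) + star H b (T y))"

definition quasitubes :: "('f::rc_scalar, 'h::banach) based_space \<Rightarrow> ('h \<Rightarrow> 'h) set" where
  "quasitubes H = {T. H_linear H T \<and> (\<exists>K. \<forall>x. norm (T x) \<le> K * norm x)}"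

definition qt_pi :: "('f, 'h) based_space \<Rightarrow> ('h \<Rightarrow> 'h) \<Rightarrow> int \<Rightarrow> 'f" where
  "qt_pi H q k = ip H (q (bas H k)) (bas H k)"

definition qt_selfadjoint :: "('f, 'h) based_space \<Rightarrow> ('h \<Rightarrow> 'h) \<Rightarrow> bool" where
  "qt_selfadjoint H q \<longleftrightarrow> (\<forall>x y. ip H (q x) y = ip H x (q y))"

definition qt_invertible :: "('f::rc_scalar, 'h::banach) based_space \<Rightarrow> ('h \<Rightarrow> 'h) \<Rightarrow> bool" where
  "qt_invertible H q \<longleftrightarrow> (\<exists>c\<in>quasitubes H. c \<circ> q = id \<and> q \<circ> c = id)"

definition qt_spectrum :: "('f::rc_scalar, 'h::banach) based_space \<Rightarrow> ('h \<Rightarrow> 'h) \<Rightarrow> 'f set" where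
  "qt_spectrum H q = {z. \<not> qt_invertible H (\<lambda>x. q x - scl H z x)}"

definition qt_ge :: "('f::rc_scalar, 'h::banach) based_space \<Rightarrow> ('h \<Rightarrow> 'h) \<Rightarrow> ('h \<Rightarrow> 'h) \<Rightarrow> bool" where
  "qt_ge H a b \<longleftrightarrow>
    qt_selfadjoint H (\<lambda>x. a x - b x) \<and> qt_spectrum H (\<lambda>x. a x - b x) \<subseteq> of_real ` {0..}"


section \<open>Quasitubal tensors\<close>

text \<open>
  Indices start at 0.  Only the entrywise difference of tensors uses the pointwise
  operations on functions; products of quasitubes are compositions.
\<close>

definition qtensors ::
  "('f::rc_scalar, 'h::banach) based_space \<Rightarrow> nat \<Rightarrow> nat \<Rightarrow> ('h \<Rightarrow> 'h) mat set" where
  "qtensors H m p = {X \<in> carrier_mat m p. elements_mat X \<subseteq> quasitubes H}"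

definition slice :: "('f, 'h) based_space \<Rightarrow> ('h \<Rightarrow> 'h) mat \<Rightarrow> int \<Rightarrow> 'f mat" where
  "slice H X k = map_mat (\<lambda>q. qt_pi H q k) X"

text \<open>
  The tensor with prescribed transformed slices, obtained by inverting the bijection
  \<open>qt_pi H\<close> from the quasitubes onto the bounded sequences in every entry.
\<close>

definition of_slices ::
  "('f::rc_scalar, 'h::banach) based_space \<Rightarrow> nat \<Rightarrow> nat \<Rightarrow> (int \<Rightarrow> 'f mat) \<Rightarrow> ('h \<Rightarrow> 'h) mat" where
  "of_slices H m p A =
    mat m p (\<lambda>(i, j). inv_into (quasitubes H) (qt_pi H) (\<lambda>k. A k $$ (i, j)))"

definition qt_times ::
  "('f::rc_scalar, 'h::banach) based_space \<Rightarrow> ('h \<Rightarrow> 'h) mat \<Rightarrow> ('h \<Rightarrow> 'h) mat \<Rightarrow> ('h \<Rightarrow> 'h) mat" where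
  "qt_times H X Y = of_slices H (dim_row X) (dim_col Y) (\<lambda>k. slice H X k * slice H Y k)"

definition qt_adjoint ::
  "('f::rc_scalar, 'h::banach) based_space \<Rightarrow> ('h \<Rightarrow> 'h) mat \<Rightarrow> ('h \<Rightarrow> 'h) mat" where
  "qt_adjoint H X = of_slices H (dim_col X) (dim_row X) (\<lambda>k. mat_adjoint (slice H X k))"

definition qt_identity :: "nat \<Rightarrow> ('h::banach \<Rightarrow> 'h) mat" where
  "qt_identity n = mat n n (\<lambda>(i, j). if i = j then id else (\<lambda>x. 0))"

definition qt_unitary ::
  "('f::rc_scalar, 'h::banach) based_space \<Rightarrow> nat \<Rightarrow> ('h \<Rightarrow> 'h) mat \<Rightarrow> bool" where
  "qt_unitary H n U \<longleftrightarrow> U \<in> qtensors H n n \<and>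
    qt_times H (qt_adjoint H U) U = qt_identity n \<and>
    qt_times H U (qt_adjoint H U) = qt_identity n"

definition f_diagonal ::
  "('f::rc_scalar, 'h::banach) based_space \<Rightarrow> ('h \<Rightarrow> 'h) mat \<Rightarrow> bool" where
  "f_diagonal H S \<longleftrightarrow> (\<forall>k. diagonal_mat (slice H S k))"

definition qt_apply :: "('h::banach \<Rightarrow> 'h) mat \<Rightarrow> 'h vec \<Rightarrow> 'h vec" where
  "qt_apply B v = vec (dim_row B) (\<lambda>i. \<Sum>j<dim_col B. (B $$ (i, j)) (v $ j))"

definition hvec_norm :: "'h::banach vec \<Rightarrow> real" where
  "hvec_norm v = sqrt (\<Sum>j<dim_vec v. (norm (v $ j))\<^sup>2)"

definition op_norm :: "('h::banach \<Rightarrow> 'h) mat \<Rightarrow> real" where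
  "op_norm B = Sup {hvec_norm (qt_apply B v) | v. v \<in> carrier_vec (dim_col B) \<and> hvec_norm v = 1}"


section \<open>The q-SVD, ranks and truncations\<close>

definition q_svd ::
  "('f::rc_scalar, 'h::banach) based_space \<Rightarrow> nat \<Rightarrow> nat \<Rightarrow> ('h \<Rightarrow> 'h) mat \<Rightarrow>
    ('h \<Rightarrow> 'h) mat \<Rightarrow> ('h \<Rightarrow> 'h) mat \<Rightarrow> ('h \<Rightarrow> 'h) mat \<Rightarrow> bool" where
  "q_svd H m p X U S V \<longleftrightarrow>
    qt_unitary H m U \<and> qt_unitary H p V \<and> S \<in> qtensors H m p \<and> f_diagonal H S \<and>
    (\<forall>i. Suc i < min m p \<longrightarrow> qt_ge H (S $$ (i, i)) (S $$ (Suc i, Suc i))) \<and>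
    (\<forall>i < min m p. qt_ge H (S $$ (i, i)) (\<lambda>x. 0)) \<and>
    X = qt_times H (qt_times H U S) (qt_adjoint H V)"

text \<open>
  The q-rank as a relation: the number of non-zero singular quasitubes in a q-SVD of the tensor.
  Every tensor has a q-SVD and the singular quasitubes do not depend on it, so the relation is
  the graph of a total function.
\<close>

definition has_q_rank ::
  "('f::rc_scalar, 'h::banach) based_space \<Rightarrow> nat \<Rightarrow> nat \<Rightarrow> ('h \<Rightarrow> 'h) mat \<Rightarrow> nat \<Rightarrow> bool" where
  "has_q_rank H m p X n \<longleftrightarrow>
    (\<exists>U S V. q_svd H m p X U S V \<and> n = card {i. i < min m p \<and> S $$ (i, i) \<noteq> (\<lambda>x. 0)})"

definition multi_rank ::
  "('f::rc_scalar, 'h::banach) based_space \<Rightarrow> ('h \<Rightarrow> 'h) mat \<Rightarrow> int \<Rightarrow> nat" where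
  "multi_rank H X k = vec_space.rank (dim_row X) (slice H X k)"

definition multi_rank_trunc ::
  "('f::rc_scalar, 'h::banach) based_space \<Rightarrow> ('h \<Rightarrow> 'h) mat \<Rightarrow> ('h \<Rightarrow> 'h) mat \<Rightarrow>
    ('h \<Rightarrow> 'h) mat \<Rightarrow> (int \<Rightarrow> nat) \<Rightarrow> ('h \<Rightarrow> 'h) mat" where
  "multi_rank_trunc H U S V \<rho> = of_slices H (dim_row S) (dim_col S) (\<lambda>k.
    submatrix (slice H U k) UNIV {..<\<rho> k} *
    submatrix (slice H S k) {..<\<rho> k} {..<\<rho> k} *
    mat_adjoint (submatrix (slice H V k) UNIV {..<\<rho> k}))"

definition q_rank_trunc ::
  "('f::rc_scalar, 'h::banach) based_space \<Rightarrow> ('h \<Rightarrow> 'h) mat \<Rightarrow> ('h \<Rightarrow> 'h) mat \<Rightarrow>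
    ('h \<Rightarrow> 'h) mat \<Rightarrow> nat \<Rightarrow> ('h \<Rightarrow> 'h) mat" where
  "q_rank_trunc H U S V r =
    qt_times H (qt_times H (submatrix U UNIV {..<r}) (submatrix S {..<r} {..<r}))
      (qt_adjoint H (submatrix V UNIV {..<r}))"

end

theory Submission
  imports Defs "HOL-Analysis.Elementary_Metric_Spaces"
begin

text \<open>
  In the coordinates of the orthonormal basis a quasitube acts as multiplication by a bounded
  sequence, and every bounded sequence arises in this way.  A tensor \<open>B\<close> therefore acts on the
  \<open>k\<close>-th coordinates of a vector as the matrix \<open>slice H B k\<close>, and Parseval's identity shows that
  \<open>op_norm B\<close> is the supremum over \<open>k\<close> of the spectral norms of the slices.  It remains to prove
  the Eckart--Young inequality in each slice.  A competitor \<open>B\<close> of rank at most \<open>r\<close> annihilates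
  some nonzero \<open>w\<close> in the span of the first \<open>r + 1\<close> right singular vectors of \<open>A\<close>, so
  the norm of \<open>(A - B) w = A w\<close> is at least the \<open>(r + 1)\<close>-st singular value times that of
  \<open>w\<close>; and this singular value is the spectral norm of \<open>A\<close> minus its truncation.
  The truncation by q-rank is the truncation by a constant multi-rank, and a tensor of q-rank at
  most \<open>r\<close> has slices with at most \<open>r\<close> nonzero singular values.
\<close>

section \<open>Coordinates in the Hilbert space\<close>

text \<open>Follows by taking norms in \<open>mult_conjugate\<close> and cancelling
  \<open>norm x\<close>, which is why zero is split off.\<close>

lemma norm_conjugate [simp]: "norm (conjugate x) = norm (x :: 'f::rc_scalar)"
proof (cases "x = 0")
  case False
  have "norm (x * conjugate x) = norm x ^ 2"
    by (simp add: mult_conjugate)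
  with False show ?thesis
    by (simp add: norm_mult power2_eq_square)
qed simp

lemma conjugate_of_real [simp]: "conjugate (of_real c :: 'f::rc_scalar) = of_real c"
proof (cases "c = 0")
  case False
  have "of_real c * conjugate (of_real c :: 'f) = of_real c * of_real c"
    by (simp add: mult_conjugate scaleR_conv_of_real power2_eq_square)
  with False show ?thesis
    by simp
qed simp

context based_hilbert_space
begin

section \<open>Algebra of the inner product and of coordinates\<close>

lemma ip_zero_left [simp]: "ip H 0 z = 0"
  using ip_add_left[of 0 0 z] by simp

lemma ip_minus_left: "ip H (- x) z = - ip H x z"
  using ip_add_left[of x "- x" z] by (simp add: eq_neg_iff_add_eq_0 add.commute)

lemma ip_diff_left: "ip H (x - y) z = ip H x z - ip H y z"
  using ip_add_left[of x "- y" z] by (simp add: ip_minus_left)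

lemma ip_add_right: "ip H z (x + y) = ip H z x + ip H z y"
  by (metis conjugate_dist_add ip_add_left ip_commute)

lemma ip_scl_right: "ip H z (scl H a x) = conjugate a * ip H z x"
  by (metis conjugate_dist_mul ip_scl_left ip_commute)

lemma ip_zero_right [simp]: "ip H z 0 = 0"
  using ip_add_right[of z 0 0] by simp

lemma ip_sum_right: "ip H z (\<Sum>j\<in>F. g j) = (\<Sum>j\<in>F. ip H z (g j))"
  by (induction F rule: infinite_finite_induct) (simp_all add: ip_add_right)

lemma norm_scl: "norm (scl H a x) = norm a * norm x"
proof -
  have "of_real ((norm (scl H a x))\<^sup>2) = (a * conjugate a) * ip H x x"
    by (simp only: ip_self[symmetric] ip_scl_left ip_scl_right mult.assoc mult.left_commute)
  also have "\<dots> = of_real ((norm a * norm x)\<^sup>2)"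
    by (simp add: mult_conjugate ip_self scaleR_conv_of_real power_mult_distrib)
  finally have "(norm (scl H a x))\<^sup>2 = (norm a * norm x)\<^sup>2"
    by (simp only: of_real_eq_iff)
  then show ?thesis
    by (simp add: power2_eq_iff_nonneg)
qed

lemma norm_bas [simp]: "norm (bas H k) = 1"
proof -
  have "of_real ((norm (bas H k))\<^sup>2) = (of_real 1 :: 'f)"
    by (simp only: ip_self[symmetric] bas_orthonormal if_True of_real_1 refl)
  then have "(norm (bas H k))\<^sup>2 = 1"
    by (simp only: of_real_eq_iff)
  then show ?thesis
    using power2_eq_iff_nonneg[of "norm (bas H k)" 1] by simp
qed

lemma inj_bas: "inj (bas H)"
  by (rule injI) (metis bas_orthonormal zero_neq_one)

lemma coord_add: "coord H (x + y) j = coord H x j + coord H y j"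
  by (simp add: coord_def ip_add_left)

lemma coord_diff: "coord H (x - y) j = coord H x j - coord H y j"
  by (simp add: coord_def ip_diff_left)

lemma coord_scl: "coord H (scl H a x) j = a * coord H x j"
  by (simp add: coord_def ip_scl_left)

lemma coord_zero [simp]: "coord H 0 j = 0"
  by (simp add: coord_def)

lemma coord_sum: "coord H (\<Sum>i\<in>I. g i) j = (\<Sum>i\<in>I. coord H (g i) j)"
  by (induction I rule: infinite_finite_induct) (simp_all add: coord_add)

lemma coord_bas: "coord H (bas H i) j = (if i = j then 1 else 0)"
  by (simp add: coord_def bas_orthonormal)

section \<open>Finite expansions and Bessel's identity\<close>

lemma coord_expansion:
  assumes "finite F"
  shows "coord H (\<Sum>j\<in>F. scl H (f j) (bas H j)) k = (if k \<in> F then f k else 0)"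
proof -
  have "coord H (\<Sum>j\<in>F. scl H (f j) (bas H j)) k = (\<Sum>j\<in>F. if j = k then f j else 0)"
    by (simp add: coord_sum coord_scl coord_bas if_distrib cong: if_cong)
  then show ?thesis
    using assms by simp
qed

lemma pythagoras:
  assumes "ip H x y = 0"
  shows "(norm (x + y))\<^sup>2 = (norm x)\<^sup>2 + (norm y)\<^sup>2"
proof -
  have "ip H y x = 0"
    using assms by (metis ip_commute conjugate_zero)
  then have "(of_real ((norm (x + y))\<^sup>2) :: 'f) = of_real ((norm x)\<^sup>2 + (norm y)\<^sup>2)"
    unfolding of_real_add ip_self[symmetric] using assms
    by (simp add: ip_add_left ip_add_right)
  then show ?thesis
    by (simp only: of_real_eq_iff)
qed

lemma norm_expansion:
  assumes "finite F"
  shows "(norm (\<Sum>j\<in>F. scl H (f j) (bas H j)))\<^sup>2 = (\<Sum>j\<in>F. (norm (f j))\<^sup>2)"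
  using assms
proof (induction F)
  case (insert i F)
  have "ip H (\<Sum>j\<in>F. scl H (f j) (bas H j)) (scl H (f i) (bas H i)) = 0"
    using insert coord_expansion[of F f i] by (simp add: ip_scl_right coord_def)
  from pythagoras[OF this] insert show ?case
    by (simp add: norm_scl add.commute)
qed simp

text \<open>The remainder of a finite expansion is orthogonal to every basis vector in
  \<open>F\<close>, so Pythagoras applies. Keeping it as an identity serves two purposes: it bounds
  the coordinates by \<open>norm x\<close>, and it shows that passing to the remainder never
  increases the norm.\<close>

lemma bessel:
  assumes "finite F"
  shows "(norm x)\<^sup>2 = (norm (x - (\<Sum>j\<in>F. scl H (coord H x j) (bas H j))))\<^sup>2
    + (\<Sum>j\<in>F. (norm (coord H x j))\<^sup>2)"
proof -
  let ?P = "\<Sum>j\<in>F. scl H (coord H x j) (bas H j)"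
  have "ip H (x - ?P) (bas H j) = 0" if "j \<in> F" for j
    using coord_expansion[OF assms, of "coord H x" j] that
    by (simp add: coord_def ip_diff_left)
  then have "ip H (x - ?P) ?P = 0"
    by (simp add: ip_sum_right ip_scl_right)
  from pythagoras[OF this] show ?thesis
    by (simp add: norm_expansion[OF assms])
qed

lemma sum_coord_le:
  assumes "finite F"
  shows "(\<Sum>j\<in>F. (norm (coord H x j))\<^sup>2) \<le> (norm x)\<^sup>2"
  using bessel[OF assms, of x] by simp

lemma norm_coord_le: "norm (coord H x j) \<le> norm x"
  using sum_coord_le[of "{j}" x] by (simp add: abs_le_square_iff[symmetric])

lemma bounded_linear_coord: "bounded_linear (\<lambda>x. coord H x j)"
proof (rule bounded_linear_intro)
  show "coord H (r *\<^sub>R x) j = r *\<^sub>R coord H x j" for r x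
    by (simp add: scl_of_real[symmetric] coord_scl scaleR_conv_of_real)
  show "norm (coord H x j) \<le> norm x * 1" for x
    by (simp add: norm_coord_le)
qed (rule coord_add)

section \<open>Convergence of basis expansions, Parseval and Riesz-Fischer\<close>

lemma span_bas_expansion:
  assumes "y \<in> local.span (range (bas H))"
  obtains F where "finite F"
    "\<And>G. finite G \<Longrightarrow> F \<subseteq> G \<Longrightarrow> (\<Sum>j\<in>G. scl H (coord H y j) (bas H j)) = y"
proof -
  obtain t r where t: "finite t" "t \<subseteq> range (bas H)" "y = (\<Sum>a\<in>t. scl H (r a) a)"
    using assms unfolding span_explicit by blast
  obtain F where F: "finite F" "t = bas H ` F"
    using finite_subset_image[OF t(1,2)] by blast
  have y: "y = (\<Sum>j\<in>F. scl H (r (bas H j)) (bas H j))"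
    unfolding t(3) F(2) by (subst sum.reindex) (auto intro: inj_on_subset[OF inj_bas])
  have c: "coord H y j = (if j \<in> F then r (bas H j) else 0)" for j
    unfolding y by (rule coord_expansion[OF F(1)])
  \<comment> \<open>\<open>F\<close> contains the support of the coordinates of \<open>y\<close>, so
    enlarging it only adds zero terms.\<close>
  have "(\<Sum>j\<in>G. scl H (coord H y j) (bas H j)) = y" if "finite G" "F \<subseteq> G" for G
  proof -
    have "(\<Sum>j\<in>G. scl H (coord H y j) (bas H j)) = (\<Sum>j\<in>F. scl H (coord H y j) (bas H j))"
      by (rule sum.mono_neutral_right) (use that c in auto)
    also have "\<dots> = y"
      by (subst (2) y, rule sum.cong) (simp_all add: c)
    finally show ?thesis .
  qed
  with F(1) show ?thesis
    by (rule that)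
qed

text \<open>Density gives \<open>y\<close> in the span close to \<open>x\<close>. Once the finite
  set contains the support of \<open>y\<close>, the partial sum reproduces \<open>y\<close>, so the
  error for \<open>x\<close> equals the error for \<open>x - y\<close>, which Bessel bounds by
  \<open>norm (x - y)\<close>.\<close>

lemma has_sum_expansion: "((\<lambda>j. scl H (coord H x j) (bas H j)) has_sum x) UNIV"
  unfolding has_sum_def tendsto_iff
proof (intro allI impI)
  fix e :: real
  assume "e > 0"
  moreover have "x \<in> closure (local.span (range (bas H)))"
    by (simp add: bas_total)
  ultimately obtain y where y: "y \<in> local.span (range (bas H))" "dist y x < e"
    unfolding closure_approachable by blast
  obtain F where F: "finite F"
    "\<And>G. finite G \<Longrightarrow> F \<subseteq> G \<Longrightarrow> (\<Sum>j\<in>G. scl H (coord H y j) (bas H j)) = y"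
    using span_bas_expansion[OF y(1)] by blast
  have "dist (\<Sum>j\<in>G. scl H (coord H x j) (bas H j)) x < e" if G: "finite G" "F \<subseteq> G" for G
  proof -
    let ?P = "\<lambda>z. \<Sum>j\<in>G. scl H (coord H z j) (bas H j)"
    have "?P (x - y) = ?P x - y"
      by (simp add: coord_diff scale_left_diff_distrib sum_subtractf F(2)[OF G])
    then have "x - ?P x = (x - y) - ?P (x - y)"
      by simp
    moreover have "(norm ((x - y) - ?P (x - y)))\<^sup>2 \<le> (norm (x - y))\<^sup>2"
      unfolding bessel[OF G(1), of "x - y"] by (simp add: sum_nonneg)
    ultimately have "norm (x - ?P x) \<le> norm (x - y)"
      by (metis norm_ge_zero power2_le_imp_le)
    then show ?thesis
      using y(2) by (simp add: dist_norm norm_minus_commute)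
  qed
  with F(1) show "\<forall>\<^sub>F G in finite_subsets_at_top UNIV.
      dist (\<Sum>j\<in>G. scl H (coord H x j) (bas H j)) x < e"
    unfolding eventually_finite_subsets_at_top by blast
qed

lemma parseval: "((\<lambda>j. (norm (coord H x j))\<^sup>2) has_sum (norm x)\<^sup>2) UNIV"
  unfolding has_sum_def
proof (rule Lim_transform_eventually)
  show "((\<lambda>F. (norm (\<Sum>j\<in>F. scl H (coord H x j) (bas H j)))\<^sup>2) \<longlongrightarrow> (norm x)\<^sup>2)
      (finite_subsets_at_top UNIV)"
    using has_sum_expansion[of x] unfolding has_sum_def
    by (intro tendsto_power tendsto_norm)
  show "\<forall>\<^sub>F F in finite_subsets_at_top UNIV.
      (norm (\<Sum>j\<in>F. scl H (coord H x j) (bas H j)))\<^sup>2 = (\<Sum>j\<in>F. (norm (coord H x j))\<^sup>2)"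
    by (rule eventually_finite_subsets_at_top_weakI) (rule norm_expansion)
qed

lemma coord_eqI:
  assumes "\<And>j. coord H x j = coord H y j"
  shows "x = y"
proof -
  have "((\<lambda>j. (norm (coord H (x - y) j))\<^sup>2) has_sum 0) UNIV"
    by (rule has_sum_0) (simp add: coord_diff assms)
  with parseval[of "x - y"] have "(norm (x - y))\<^sup>2 = 0"
    by (rule has_sum_unique)
  then show ?thesis
    by simp
qed

text \<open>Completeness of the space enters here: the partial sums are Cauchy because their squared
  distances are differences of the bounded monotone sequence \<open>a\<close>.\<close>

lemma riesz_fischer:
  assumes bound: "\<And>F. finite F \<Longrightarrow> (\<Sum>j\<in>F. (norm (f j))\<^sup>2) \<le> B"
  obtains x where "\<And>j. coord H x j = f j"
proof -
  \<comment> \<open>Symmetric intervals exhaust the integers, which turns the net of finite sets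
    into a sequence.\<close>
  define I where "I n = {- int n..int n}" for n :: nat
  define S where "S n = (\<Sum>j\<in>I n. scl H (f j) (bas H j))" for n
  define a where "a n = (\<Sum>j\<in>I n. (norm (f j))\<^sup>2)" for n
  have I: "finite (I n)" for n
    by (simp add: I_def)
  have I_mono: "I k \<subseteq> I n" if "k \<le> n" for k n
    using that by (auto simp: I_def)
  have S_diff: "(norm (S n - S k))\<^sup>2 = \<bar>a n - a k\<bar>" if "k \<le> n" for k n
  proof -
    have "S n - S k = (\<Sum>j\<in>I n - I k. scl H (f j) (bas H j))"
      unfolding S_def by (rule sum_diff[symmetric]) (auto simp: I I_mono that)
    moreover have "a n - a k = (\<Sum>j\<in>I n - I k. (norm (f j))\<^sup>2)"
      unfolding a_def by (rule sum_diff[symmetric]) (auto simp: I I_mono that)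
    ultimately show ?thesis
      by (simp add: norm_expansion I sum_nonneg)
  qed
  have S_diff': "(norm (S n - S k))\<^sup>2 = \<bar>a n - a k\<bar>" for k n
    using S_diff[of k n] S_diff[of n k]
    by (cases "k \<le> n") (simp_all add: norm_minus_commute abs_minus_commute)
  have "incseq a"
    unfolding a_def by (intro monoI sum_mono2) (auto simp: I I_mono)
  moreover have "a n \<le> B" for n
    unfolding a_def by (rule bound) (rule I)
  ultimately have "Cauchy a"
    by (metis convergent_Cauchy convergentI incseq_convergent)
  have "Cauchy S"
  proof (rule CauchyI)
    fix e :: real
    assume "e > 0"
    then obtain M where "\<And>k n. k \<ge> M \<Longrightarrow> n \<ge> M \<Longrightarrow> norm (a k - a n) < e\<^sup>2"
      using CauchyD[OF \<open>Cauchy a\<close>, of "e\<^sup>2"] by auto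
    then have "(norm (S k - S n))\<^sup>2 < e\<^sup>2" if "k \<ge> M" "n \<ge> M" for k n
      using that by (simp add: S_diff')
    then show "\<exists>M. \<forall>k\<ge>M. \<forall>n\<ge>M. norm (S k - S n) < e"
      using \<open>e > 0\<close> by (meson less_imp_le power_less_imp_less_base)
  qed
  then obtain x where x: "S \<longlonglongrightarrow> x"
    by (auto simp: Cauchy_convergent_iff convergent_def)
  \<comment> \<open>The coordinate functional is continuous, and coordinate \<open>j\<close> of
    \<open>S n\<close> equals \<open>f j\<close> as soon as \<open>n\<close> reaches
    \<open>nat \<bar>j\<bar>\<close>.\<close>
  have "coord H x j = f j" for j
  proof (rule LIMSEQ_unique)
    show "(\<lambda>n. coord H (S n) j) \<longlonglongrightarrow> coord H x j"
      by (rule bounded_linear.tendsto[OF bounded_linear_coord x])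
    have "\<forall>\<^sub>F n in sequentially. coord H (S n) j = f j"
      unfolding S_def
      by (rule eventually_sequentiallyI[of "nat \<bar>j\<bar>"])
        (subst coord_expansion[OF I], auto simp: I_def)
    then show "(\<lambda>n. coord H (S n) j) \<longlonglongrightarrow> f j"
      by (simp add: tendsto_eventually)
  qed
  then show ?thesis
    by (rule that)
qed

section \<open>Coordinatewise products\<close>

lemma exists_coord_mult:
  assumes "\<And>j. norm (c j) \<le> K"
  obtains z where "\<And>j. coord H z j = c j * coord H x j"
proof (rule riesz_fischer[of "\<lambda>j. c j * coord H x j" "K\<^sup>2 * (norm x)\<^sup>2"])
  fix F :: "int set"
  assume F: "finite F"
  have "(\<Sum>j\<in>F. (norm (c j * coord H x j))\<^sup>2) \<le> (\<Sum>j\<in>F. K\<^sup>2 * (norm (coord H x j))\<^sup>2)"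
    by (intro sum_mono) (simp add: norm_mult power_mult_distrib assms mult_right_mono power_mono)
  also have "\<dots> \<le> K\<^sup>2 * (norm x)\<^sup>2"
    by (simp add: sum_distrib_left[symmetric] mult_left_mono sum_coord_le[OF F])
  finally show "(\<Sum>j\<in>F. (norm (c j * coord H x j))\<^sup>2) \<le> K\<^sup>2 * (norm x)\<^sup>2" .
qed (rule that)

text \<open>An infinite sum defaults to 0 when the family is not summable, so a vector with the
  product coordinates is produced first: the coordinates of \<open>x\<close> are a bounded
  multiplier. The defining sum of \<open>star\<close> is then the basis expansion of that
  vector.\<close>

lemma coord_star [simp]: "coord H (star H x y) j = coord H x j * coord H y j"
proof -
  obtain z where z: "\<And>j. coord H z j = coord H x j * coord H y j"
    using exists_coord_mult[of "coord H x" "norm x" y, OF norm_coord_le] by blast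
  have "star H x y = z"
    unfolding star_def z[symmetric] by (rule infsumI[OF has_sum_expansion])
  with z show ?thesis
    by simp
qed

lemma norm_le_of_coord_mult:
  assumes "\<And>j. norm (c j) \<le> K" "K \<ge> 0" "\<And>j. coord H z j = c j * coord H x j"
  shows "norm z \<le> K * norm x"
proof -
  have "(norm z)\<^sup>2 \<le> K\<^sup>2 * (norm x)\<^sup>2"
  proof (rule has_sum_mono[OF parseval has_sum_cmult_right[OF parseval]])
    fix j :: int
    show "(norm (coord H z j))\<^sup>2 \<le> K\<^sup>2 * (norm (coord H x j))\<^sup>2"
      by (simp add: assms(3) norm_mult power_mult_distrib assms(1) mult_right_mono power_mono)
  qed
  then show ?thesis
    using assms(2) by - (rule power2_le_imp_le, simp_all add: power_mult_distrib)
qed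

end


section \<open>Kernels of matrices of small rank\<close>

text \<open>Connects the action of \<open>B\<close> with its rank, which is the dimension of the
  span of the columns.\<close>

lemma mult_mat_vec_in_span_cols:
  assumes "B \<in> carrier_mat n p" "c \<in> carrier_vec p"
  shows "B *\<^sub>v (c :: 'a::field vec) \<in> module.span class_ring (module_vec TYPE('a) n) (set (cols B))"
proof -
  interpret vec_space "TYPE('a)" n .
  have cols: "set (cols B) \<subseteq> carrier_vec n"
    using cols_dim[of B] assms(1) by simp
  have "vec (length (cols B)) (\<lambda>i. c $ i) = c"
    using assms by (intro eq_vecI) auto
  then have "B *\<^sub>v c = lincomb_list (\<lambda>i. c $ i) (cols B)"
    using assms cols mat_of_cols_cols[of B] by (subst lincomb_list_as_mat_mult) auto
  then have "B *\<^sub>v c \<in> span_list (cols B)"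
    unfolding span_list_def by blast
  then show ?thesis
    using span_list_as_span[OF cols] by simp
qed

text \<open>Linear independence concerns the set of columns, where repetitions disappear, so
  distinctness is a separate claim: equal columns \<open>i\<close> and \<open>j\<close> would put
  the difference of two unit vectors into the kernel.\<close>

lemma trivial_kernel_imp_lin_indpt:
  assumes A: "A \<in> carrier_mat n q"
    and ker: "\<And>c. c \<in> carrier_vec q \<Longrightarrow> A *\<^sub>v (c :: 'a::field vec) = 0\<^sub>v n \<Longrightarrow> c = 0\<^sub>v q"
  shows "distinct (cols A)"
    and "\<not> module.lin_dep class_ring (module_vec TYPE('a) n) (set (cols A))"
proof -
  interpret vec_space "TYPE('a)" n .
  show dist: "distinct (cols A)"
    unfolding distinct_conv_nth
  proof (intro allI impI notI)
    fix i j
    assume ij: "i < length (cols A)" "j < length (cols A)" "i \<noteq> j" "cols A ! i = cols A ! j"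
    then have lt: "i < q" "j < q"
      using A by auto
    have "A *\<^sub>v (unit_vec q i - unit_vec q j) = A *\<^sub>v unit_vec q i - A *\<^sub>v unit_vec q j"
      by (rule mult_minus_distrib_mat_vec[OF A]) auto
    also have "\<dots> = 0\<^sub>v n"
    proof (rule eq_vecI)
      fix l
      assume "l < dim_vec (0\<^sub>v n :: 'a vec)"
      then have l: "l < n" by simp
      have "A $$ (l, i) = A $$ (l, j)"
        using ij l lt A by (metis cols_nth carrier_matD index_col)
      with l lt A show "(A *\<^sub>v unit_vec q i - A *\<^sub>v unit_vec q j) $ l = 0\<^sub>v n $ l"
        by (simp add: scalar_prod_right_unit)
    qed (use A in simp)
    finally have "unit_vec q i - unit_vec q j = (0\<^sub>v q :: 'a vec)"
      by (intro ker) auto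
    from arg_cong[OF this, of "\<lambda>v. v $ i"] lt ij(3) show False
      by simp
  qed
  show "lin_indpt (set (cols A))"
  proof
    assume "lin_dep (set (cols A))"
    from lin_depE[OF A this dist] ker show False
      by blast
  qed
qed

text \<open>If \<open>B * W\<close> were injective, its \<open>q\<close> columns would be distinct
  and independent inside the column space of \<open>B\<close>, whose dimension is the rank; but the
  rank is below \<open>q\<close>.\<close>

lemma rank_less_imp_kernel:
  assumes B: "B \<in> carrier_mat n p" and W: "W \<in> carrier_mat p q"
    and rank: "vec_space.rank n (B :: 'a::field mat) < q"
  obtains c where "c \<in> carrier_vec q" "c \<noteq> 0\<^sub>v q" "(B * W) *\<^sub>v c = 0\<^sub>v n"
proof (rule ccontr)
  assume "\<not> thesis"
  with that have ker: "\<And>c. c \<in> carrier_vec q \<Longrightarrow> (B * W) *\<^sub>v c = 0\<^sub>v n \<Longrightarrow> c = 0\<^sub>v q"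
    by blast
  interpret vec_space "TYPE('a)" n .
  let ?S = "span (set (cols B))"
  have BW: "B * W \<in> carrier_mat n q"
    using B W by simp
  have cols: "set (cols B) \<subseteq> carrier_vec n"
    using cols_dim[of B] B by simp
  note indpt = trivial_kernel_imp_lin_indpt[OF BW ker]
  have sub: "set (cols (B * W)) \<subseteq> ?S"
  proof
    fix x
    assume "x \<in> set (cols (B * W))"
    then obtain j where j: "j < q" "x = col (B * W) j"
      using BW by (auto simp: cols_def)
    then have "x = B *\<^sub>v col W j"
      using col_mult2[OF B W] by simp
    then show "x \<in> ?S"
      using mult_mat_vec_in_span_cols[OF B] W j(1) by simp
  qed
  \<comment> \<open>The dimension bound is applied inside the column space, viewed as a vector space
    of its own.\<close>
  have vs: "vectorspace class_ring (vs ?S)"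
    using span_is_subspace[of "set (cols B)"] cols by (intro subspace_is_vs) simp
  have "LinearCombinations.module.lin_indpt class_ring (vs ?S) (set (cols (B * W)))"
    using indpt(2) span_li_not_depend(2)[OF sub span_is_submodule] cols by simp
  then have "card (set (cols (B * W))) \<le> rank B"
    unfolding rank_def
    by (intro vectorspace.li_le_dim(2)[OF vs fin_dim_span_cols[OF B]]) (use sub in auto)
  moreover have "card (set (cols (B * W))) = q"
    using distinct_card[OF indpt(1)] W by simp
  ultimately show False
    using rank by simp
qed

text \<open>Kernel criterion for the q-rank, where the nonzero rows can be counted. The possibly
  nonzero rows fit into a square matrix with a spare zero row, whose determinant vanishes.\<close>

lemma few_rows_imp_kernel:
  assumes G: "G \<in> carrier_mat n q" and I: "finite I" "card I < q"
    and zero: "\<And>i. i < n \<Longrightarrow> i \<notin> I \<Longrightarrow> row G i = (0\<^sub>v q :: 'a::field vec)"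
  obtains c where "c \<in> carrier_vec q" "c \<noteq> 0\<^sub>v q" "G *\<^sub>v c = 0\<^sub>v n"
proof -
  obtain h where h: "bij_betw h {0..<card I} I"
    using ex_bij_betw_nat_finite[OF I(1)] by blast
  \<comment> \<open>\<open>h\<close> enumerates \<open>I\<close>, so the first \<open>card I\<close>
    rows of \<open>N\<close> are the rows of \<open>G\<close> indexed by \<open>I\<close>. All
    further rows are zero, as are those whose index in \<open>I\<close> is not a row of
    \<open>G\<close>.\<close>
  define N where "N = mat q q (\<lambda>(i, j). if i < card I \<and> h i < n then G $$ (h i, j) else 0)"
  have N: "N \<in> carrier_mat q q"
    by (simp add: N_def)
  \<comment> \<open>Row \<open>card I\<close> of \<open>N\<close> exists because
    \<open>card I < q\<close>, and it is zero.\<close>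
  have "transpose_mat N *\<^sub>v unit_vec q (card I) = 0\<^sub>v q"
    using I(2) by (intro eq_vecI) (simp_all add: N_def scalar_prod_right_unit)
  moreover have "unit_vec q (card I) \<noteq> (0\<^sub>v q :: 'a vec)"
    using I(2) by simp
  ultimately have "det (transpose_mat N) = 0"
    using det_0_iff_vec_prod_zero_field[of "transpose_mat N" q] N
    by (metis transpose_carrier_mat unit_vec_carrier)
  then have "det N = 0"
    using det_transpose[OF N] by simp
  then obtain c where c: "c \<in> carrier_vec q" "c \<noteq> 0\<^sub>v q" "N *\<^sub>v c = 0\<^sub>v q"
    using det_0_iff_vec_prod_zero_field[OF N] by blast
  have "G *\<^sub>v c = 0\<^sub>v n"
  proof (rule eq_vecI)
    fix i
    assume "i < dim_vec (0\<^sub>v n :: 'a vec)"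
    then have i: "i < n" by simp
    show "(G *\<^sub>v c) $ i = 0\<^sub>v n $ i"
    proof (cases "i \<in> I")
      case False
      then show ?thesis
        using zero[OF i] i G c(1) by simp
    next
      case True
      then obtain l where l: "l < card I" "h l = i"
        using h unfolding bij_betw_def by (metis atLeastLessThan_iff image_iff)
      have "row N l = row G i"
        using l i G I(2) by (intro eq_vecI) (auto simp: N_def)
      moreover have "(N *\<^sub>v c) $ l = 0"
        using c(3) l I(2) by simp
      ultimately show ?thesis
        using i G l I(2) by (simp add: N_def)
    qed
  qed (use G in simp)
  with c that show ?thesis
    by blast
qed


section \<open>The Eckart--Young inequality for a single matrix\<close>

text \<open>The entries range over any normed space so that scalar vectors and vectors of Hilbert
  space elements share one notion; the square makes it additive over coordinates.\<close>

definition sqnorm :: "'a::real_normed_vector vec \<Rightarrow> real" where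
  "sqnorm v = (\<Sum>i<dim_vec v. (norm (v $ i))\<^sup>2)"

lemma sqnorm_nonneg: "0 \<le> sqnorm v"
  by (simp add: sqnorm_def sum_nonneg)

lemma sqnorm_pos:
  assumes "v \<in> carrier_vec n" "v \<noteq> 0\<^sub>v n"
  shows "0 < sqnorm v"
proof -
  obtain i where "i < n" "v $ i \<noteq> 0"
    using assms by (auto simp: vec_eq_iff)
  then show ?thesis
    unfolding sqnorm_def using assms(1) by (intro sum_pos2[of _ i]) auto
qed

lemma dim_mat_adjoint [simp]:
  "dim_row (mat_adjoint A) = dim_col A" "dim_col (mat_adjoint A) = dim_row A"
  by (simp_all add: mat_adjoint_def)

lemma mat_adjoint_carrier [simp]: "A \<in> carrier_mat m n \<Longrightarrow> mat_adjoint A \<in> carrier_mat n m"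
  by auto

lemma index_mat_adjoint [simp]:
  "i < dim_col A \<Longrightarrow> j < dim_row A \<Longrightarrow> mat_adjoint A $$ (i, j) = conjugate (A $$ (j, i))"
  by (simp add: mat_adjoint_def mat_of_rows_index)

lemma of_real_sqnorm:
  "of_real (sqnorm v) = (\<Sum>i<dim_vec v. v $ i * conjugate (v $ i :: 'f::rc_scalar))"
  by (simp add: sqnorm_def mult_conjugate scaleR_conv_of_real)

lemma index_mult_mat_vec_sum:
  assumes "A \<in> carrier_mat m n" "x \<in> carrier_vec n" "i < m"
  shows "(A *\<^sub>v x) $ i = (\<Sum>j<n. A $$ (i, j) * x $ j)"
  using assms by (auto simp: scalar_prod_def atLeast0LessThan intro!: sum.cong)

text \<open>Moving the second \<open>A\<close> across the inner product turns the left side into the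
  pairing of \<open>mat_adjoint A * A\<close> applied to \<open>x\<close> with
  \<open>x\<close>.\<close>

lemma sqnorm_isometry:
  assumes A: "A \<in> carrier_mat m n" and x: "x \<in> carrier_vec n"
    and iso: "mat_adjoint A * A = (1\<^sub>m n :: 'f::rc_scalar mat)"
  shows "sqnorm (A *\<^sub>v x) = sqnorm x"
proof -
  have "of_real (sqnorm (A *\<^sub>v x)) = (\<Sum>i<m. (A *\<^sub>v x) $ i * conjugate ((A *\<^sub>v x) $ i))"
    using A by (simp add: of_real_sqnorm)
  also have "\<dots> = (\<Sum>i<m. (A *\<^sub>v x) $ i * (\<Sum>j<n. conjugate (A $$ (i, j)) * conjugate (x $ j)))"
    by (intro sum.cong refl)
      (simp only: index_mult_mat_vec_sum[OF A x] sum_conjugate finite_lessThan conjugate_dist_mul lessThan_iff)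
  also have "\<dots> = (\<Sum>j<n. (\<Sum>i<m. conjugate (A $$ (i, j)) * (A *\<^sub>v x) $ i) * conjugate (x $ j))"
    unfolding sum_distrib_left sum_distrib_right by (subst sum.swap) (simp add: mult_ac)
  also have "\<dots> = (\<Sum>j<n. (mat_adjoint A *\<^sub>v (A *\<^sub>v x)) $ j * conjugate (x $ j))"
  proof (intro sum.cong refl arg_cong2[where f = "(*)"])
    fix j
    assume "j \<in> {..<n}"
    then show "(\<Sum>i<m. conjugate (A $$ (i, j)) * (A *\<^sub>v x) $ i) = (mat_adjoint A *\<^sub>v (A *\<^sub>v x)) $ j"
      using A x by (simp add: index_mult_mat_vec_sum[of "mat_adjoint A" n m] del: index_mult_mat_vec)
  qed
  also have "mat_adjoint A *\<^sub>v (A *\<^sub>v x) = (mat_adjoint A * A) *\<^sub>v x"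
    using A x by (intro assoc_mult_mat_vec[symmetric]) auto
  also have "\<dots> = x"
    using x by (simp add: iso)
  also have "(\<Sum>j<n. x $ j * conjugate (x $ j)) = of_real (sqnorm x)"
    using x by (simp add: of_real_sqnorm)
  finally show ?thesis
    by (simp only: of_real_eq_iff)
qed

text \<open>The leading block is kept at full size with zero padding, so that it can be subtracted
  from the singular value matrix and block sizes varying with the slice do not change
  dimensions.\<close>

definition corner :: "nat \<Rightarrow> 'a::zero mat \<Rightarrow> 'a mat" where
  "corner k A = mat (dim_row A) (dim_col A) (\<lambda>(i, j). if i < k \<and> j < k then A $$ (i, j) else 0)"

lemma corner_carrier [simp]: "A \<in> carrier_mat m n \<Longrightarrow> corner k A \<in> carrier_mat m n"
  by (auto simp: corner_def)

lemma pick_lessThan: "i < k \<Longrightarrow> pick {..<k} i = i"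
  using pick_card_in_set[of i "{..<k}"] by (simp add: Collect_conj_eq lessThan_def[symmetric] Int_absorb1 lessThan_subset_iff)

lemma submatrix_cols:
  assumes "A \<in> carrier_mat m n" "k \<le> n"
  shows "submatrix A UNIV {..<k} = mat m k (\<lambda>(i, j). A $$ (i, j))"
proof -
  have "{j. j < n \<and> j \<in> {..<k}} = {..<k}"
    using assms(2) by auto
  with assms(1) show ?thesis
    unfolding submatrix_def by (intro eq_matI) (auto simp: pick_lessThan pick_UNIV)
qed

lemma submatrix_corner:
  assumes "A \<in> carrier_mat m n" "k \<le> m" "k \<le> n"
  shows "submatrix A {..<k} {..<k} = mat k k (\<lambda>(i, j). A $$ (i, j))"
proof -
  have "{j. j < n \<and> j \<in> {..<k}} = {..<k}" "{j. j < m \<and> j \<in> {..<k}} = {..<k}"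
    using assms(2,3) by auto
  with assms(1) show ?thesis
    unfolding submatrix_def by (intro eq_matI) (auto simp: pick_lessThan)
qed

lemma index_mult_mat_sum:
  assumes "A \<in> carrier_mat m n" "B \<in> carrier_mat n p" "i < m" "j < p"
  shows "(A * B) $$ (i, j) = (\<Sum>l<n. A $$ (i, l) * B $$ (l, j))"
  using assms by (auto simp: scalar_prod_def atLeast0LessThan intro!: sum.cong)

text \<open>Replaces the truncated factors by full ones: every term of the matrix products with an
  inner index of at least \<open>k\<close> meets a zero entry of \<open>corner k S\<close>.\<close>

lemma truncated_product:
  assumes U: "U \<in> carrier_mat m m" and S: "S \<in> carrier_mat m p"
    and V: "(V :: 'a::conjugatable_field mat) \<in> carrier_mat p p" and k: "k \<le> m" "k \<le> p"
  shows "submatrix U UNIV {..<k} * submatrix S {..<k} {..<k} * mat_adjoint (submatrix V UNIV {..<k})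
    = U * corner k S * mat_adjoint V"
    (is "?U * ?S * ?V = _")
proof (rule eq_matI)
  fix i j
  assume "i < dim_row (U * corner k S * mat_adjoint V)" "j < dim_col (U * corner k S * mat_adjoint V)"
  then have ij: "i < m" "j < p"
    using U V by auto
  have sub: "?U \<in> carrier_mat m k" "?S \<in> carrier_mat k k" "?V \<in> carrier_mat k p"
    by (auto simp: submatrix_cols[OF U k(1)] submatrix_cols[OF V k(2)] submatrix_corner[OF S k])
  have US: "(?U * ?S) $$ (i, l) = (U * corner k S) $$ (i, l)" if "l < k" for l
  proof -
    have "(U * corner k S) $$ (i, l) = (\<Sum>a<m. U $$ (i, a) * corner k S $$ (a, l))"
      using ij that k by (intro index_mult_mat_sum[OF U corner_carrier[OF S]]) auto
    also have "\<dots> = (\<Sum>a<k. U $$ (i, a) * corner k S $$ (a, l))"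
      using k S that by (intro sum.mono_neutral_right) (auto simp: corner_def)
    also have "\<dots> = (\<Sum>a<k. ?U $$ (i, a) * ?S $$ (a, l))"
      using k S ij that
      by (intro sum.cong)
        (auto simp: corner_def submatrix_cols[OF U k(1)] submatrix_corner[OF S k])
    also have "\<dots> = (?U * ?S) $$ (i, l)"
      using sub ij that by (intro index_mult_mat_sum[symmetric]) auto
    finally show ?thesis by simp
  qed
  have zero: "(U * corner k S) $$ (i, l) = 0" if "l < p" "\<not> l < k" for l
    using U S ij that k
    by (subst index_mult_mat_sum[of _ m m _ p]) (auto simp: corner_def intro!: sum.neutral)
  have "(U * corner k S * mat_adjoint V) $$ (i, j)
      = (\<Sum>l<p. (U * corner k S) $$ (i, l) * mat_adjoint V $$ (l, j))"
    using U S V ij by (intro index_mult_mat_sum) auto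
  also have "\<dots> = (\<Sum>l<k. (U * corner k S) $$ (i, l) * mat_adjoint V $$ (l, j))"
    using k zero by (intro sum.mono_neutral_right) auto
  also have "\<dots> = (\<Sum>l<k. (?U * ?S) $$ (i, l) * ?V $$ (l, j))"
    using k V ij by (intro sum.cong) (auto simp: US submatrix_cols[OF V k(2)])
  also have "\<dots> = (?U * ?S * ?V) $$ (i, j)"
    using sub ij by (intro index_mult_mat_sum[symmetric]) auto
  finally show "(?U * ?S * ?V) $$ (i, j) = (U * corner k S * mat_adjoint V) $$ (i, j)"
    by simp
qed (use U S V k in \<open>auto simp: submatrix_cols[OF U k(1)] submatrix_cols[OF V k(2)]\<close>)

lemma mat_adjoint_adjoint [simp]: "mat_adjoint (mat_adjoint A) = (A :: 'a::conjugatable_field mat)"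
  by (rule eq_matI) auto

section \<open>Diagonal matrices and the Euclidean norm\<close>

lemma diagonal_mult_vec:
  assumes S: "S \<in> carrier_mat m p" and diag: "diagonal_mat S" and x: "x \<in> carrier_vec p"
    and i: "i < m"
  shows "(S *\<^sub>v x) $ i = (if i < p then S $$ (i, i) * x $ i else (0 :: 'a::semiring_0))"
proof -
  have "(S *\<^sub>v x) $ i = (\<Sum>j<p. S $$ (i, j) * x $ j)"
    by (rule index_mult_mat_vec_sum[OF S x i])
  also have "\<dots> = (\<Sum>j<p. if j = i then S $$ (i, i) * x $ i else 0)"
    using diag S i by (intro sum.cong) (auto simp: diagonal_mat_def)
  finally show ?thesis
    by simp
qed

lemma sqnorm_diagonal_le:
  assumes S: "S \<in> carrier_mat m p" and diag: "diagonal_mat S"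
    and x: "x \<in> carrier_vec p" and bound: "\<And>i. i < min m p \<Longrightarrow> norm (S $$ (i, i)) \<le> C"
  shows "sqnorm (S *\<^sub>v x) \<le> C\<^sup>2 * sqnorm (x :: 'f::rc_scalar vec)"
proof -
  have "sqnorm (S *\<^sub>v x) = (\<Sum>i<m. if i < p then (norm (S $$ (i, i) * x $ i))\<^sup>2 else 0)"
    unfolding sqnorm_def using S
    by (intro sum.cong) (auto simp: diagonal_mult_vec[OF S diag x] simp del: index_mult_mat_vec)
  also have "\<dots> = (\<Sum>i<min m p. (norm (S $$ (i, i) * x $ i))\<^sup>2)"
    by (simp add: sum.If_cases lessThan_def Collect_conj_eq[symmetric])
  also have "\<dots> \<le> (\<Sum>i<min m p. C\<^sup>2 * (norm (x $ i))\<^sup>2)"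
    using bound by (intro sum_mono) (auto simp: norm_mult power_mult_distrib intro!: mult_right_mono power_mono)
  also have "\<dots> \<le> (\<Sum>i<p. C\<^sup>2 * (norm (x $ i))\<^sup>2)"
    by (intro sum_mono2) auto
  finally show ?thesis
    using x by (simp add: sqnorm_def sum_distrib_left)
qed

text \<open>The entries are bounded below only for \<open>i < k\<close>, so the estimate is confined
  to vectors supported there.\<close>

lemma sqnorm_diagonal_ge:
  assumes S: "S \<in> carrier_mat m p" and diag: "diagonal_mat S" and k: "k \<le> m" "k \<le> p"
    and x: "x \<in> carrier_vec p" and supp: "\<And>i. k \<le> i \<Longrightarrow> i < p \<Longrightarrow> x $ i = 0"
    and bound: "\<And>i. i < k \<Longrightarrow> C \<le> norm (S $$ (i, i))" and C: "0 \<le> C"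
  shows "C\<^sup>2 * sqnorm (x :: 'f::rc_scalar vec) \<le> sqnorm (S *\<^sub>v x)"
proof -
  have "C\<^sup>2 * sqnorm x = (\<Sum>i<p. C\<^sup>2 * (norm (x $ i))\<^sup>2)"
    using x by (simp add: sqnorm_def sum_distrib_left)
  also have "\<dots> = (\<Sum>i<k. C\<^sup>2 * (norm (x $ i))\<^sup>2)"
    using k supp by (intro sum.mono_neutral_right) auto
  also have "\<dots> \<le> (\<Sum>i<k. (norm ((S *\<^sub>v x) $ i))\<^sup>2)"
    using k bound C
    by (intro sum_mono)
      (auto simp: diagonal_mult_vec[OF S diag x] norm_mult power_mult_distrib simp del: index_mult_mat_vec
        intro!: mult_right_mono power_mono)
  also have "\<dots> \<le> sqnorm (S *\<^sub>v x)"
    unfolding sqnorm_def using k S by (intro sum_mono2) auto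
  finally show ?thesis .
qed


text \<open>Dimension equations as side conditions let the simplifier reassociate without guessing
  carriers.\<close>

lemma mult_mat_mat_vec:
  assumes "dim_col A = dim_row B" "dim_col B = dim_vec v"
  shows "A * B *\<^sub>v v = A *\<^sub>v (B *\<^sub>v (v :: 'a::semiring_0 vec))"
  by (rule assoc_mult_mat_vec[of A "dim_row A" "dim_col A" B "dim_col B" v])
    (use assms in auto)

text \<open>Rank enters only through \<open>ker\<close>, so multi-rank and q-rank can both supply
  it. With indices from 0, \<open>S $$ (k, k)\<close> is singular value number \<open>k + 1\<close>,
  which is why \<open>ker\<close> speaks of \<open>Suc k\<close> columns.\<close>

lemma tail_le_of_kernel:
  assumes U: "U \<in> carrier_mat m m" and S: "S \<in> carrier_mat m p" and V: "V \<in> carrier_mat p p"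
    and iso: "mat_adjoint U * U = 1\<^sub>m m" "mat_adjoint V * V = (1\<^sub>m p :: 'f::rc_scalar mat)"
    and diag: "diagonal_mat S"
    and mono: "\<And>i j. i \<le> j \<Longrightarrow> j < min m p \<Longrightarrow> norm (S $$ (j, j)) \<le> norm (S $$ (i, i))"
    and k: "k < m" "k < p" and B: "B \<in> carrier_mat m p"
    and ker: "\<And>W. W \<in> carrier_mat p (Suc k) \<Longrightarrow>
      \<exists>c\<in>carrier_vec (Suc k). c \<noteq> 0\<^sub>v (Suc k) \<and> (B * W) *\<^sub>v c = 0\<^sub>v m"
    and C: "0 \<le> C"
    and bound: "\<And>w. w \<in> carrier_vec p \<Longrightarrow>
      sqnorm ((U * S * mat_adjoint V - B) *\<^sub>v w) \<le> C\<^sup>2 * sqnorm w"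
  shows "norm (S $$ (k, k)) \<le> C"
proof -
  \<comment> \<open>\<open>E\<close> embeds the first \<open>Suc k\<close> coordinates, so
    \<open>V * E\<close> consists of the first \<open>Suc k\<close> columns of \<open>V\<close>, the
    leading right singular vectors.\<close>
  define E where "E = (mat p (Suc k) (\<lambda>(i, j). if i = j then 1 else 0) :: 'f mat)"
  have E: "E \<in> carrier_mat p (Suc k)"
    by (simp add: E_def)
  obtain c where c: "c \<in> carrier_vec (Suc k)" "c \<noteq> 0\<^sub>v (Suc k)" "(B * (V * E)) *\<^sub>v c = 0\<^sub>v m"
    using ker[of "V * E"] V E by auto
  \<comment> \<open>\<open>x\<close> lists the coefficients of \<open>w\<close> in the columns of
    \<open>V\<close>; it is \<open>c\<close> padded with zeros.\<close>
  define x where "x = E *\<^sub>v c"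
  define w where "w = V *\<^sub>v x"
  have x: "x \<in> carrier_vec p" and w: "w \<in> carrier_vec p"
    using E V c(1) by (auto simp: x_def w_def)
  have x_index: "x $ i = (if i < Suc k then c $ i else 0)" if "i < p" for i
  proof -
    have "x $ i = (\<Sum>j<Suc k. E $$ (i, j) * c $ j)"
      unfolding x_def by (rule index_mult_mat_vec_sum[OF E c(1) that])
    also have "\<dots> = (\<Sum>j<Suc k. if j = i then c $ i else 0)"
      using that by (intro sum.cong) (auto simp: E_def)
    finally show ?thesis
      by simp
  qed
  obtain i where i: "i < Suc k" "c $ i \<noteq> 0"
    using c(1,2) by (auto simp: vec_eq_iff)
  with x_index[of i] k have "x $ i \<noteq> 0\<^sub>v p $ i"
    by simp
  then have "x \<noteq> 0\<^sub>v p"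
    by auto
  with x have pos: "0 < sqnorm x"
    by (rule sqnorm_pos)
  have "B *\<^sub>v w = (B * (V * E)) *\<^sub>v c"
    using B V E c(1) unfolding w_def x_def
    by (simp add: mult_mat_mat_vec)
  then have Bw: "B *\<^sub>v w = 0\<^sub>v m"
    using c(3) by simp
  have "mat_adjoint V *\<^sub>v w = x"
    unfolding w_def using V x
    by (subst assoc_mult_mat_vec[symmetric, of _ p p]) (simp_all add: iso(2))
  then have "(U * S * mat_adjoint V) *\<^sub>v w = U *\<^sub>v (S *\<^sub>v x)"
    using U S V w x by (simp add: mult_mat_mat_vec)
  moreover have "(U * S * mat_adjoint V - B) *\<^sub>v w = (U * S * mat_adjoint V) *\<^sub>v w - B *\<^sub>v w"
    using U S V B w by (intro minus_mult_distrib_mat_vec) auto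
  ultimately have "(U * S * mat_adjoint V - B) *\<^sub>v w = U *\<^sub>v (S *\<^sub>v x)"
    using U S x by (simp add: Bw)
  then have "sqnorm (S *\<^sub>v x) \<le> C\<^sup>2 * sqnorm w"
    using bound[OF w] sqnorm_isometry[OF U _ iso(1), of "S *\<^sub>v x"] S x by simp
  also have "sqnorm w = sqnorm x"
    unfolding w_def by (rule sqnorm_isometry[OF V x iso(2)])
  finally have "sqnorm (S *\<^sub>v x) \<le> C\<^sup>2 * sqnorm x" .
  \<comment> \<open>\<open>x\<close> lives on indices up to \<open>k\<close>, where monotonicity
    makes every diagonal entry at least as large in norm as entry \<open>k\<close>.\<close>
  moreover have "(norm (S $$ (k, k)))\<^sup>2 * sqnorm x \<le> sqnorm (S *\<^sub>v x)"
    using k by (intro sqnorm_diagonal_ge[OF S diag _ _ x, of "Suc k"]) (auto simp: x_index intro: mono)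
  ultimately have "(norm (S $$ (k, k)))\<^sup>2 * sqnorm x \<le> C\<^sup>2 * sqnorm x"
    by linarith
  with pos have "(norm (S $$ (k, k)))\<^sup>2 \<le> C\<^sup>2"
    by simp
  then show ?thesis
    using C by (rule power2_le_imp_le)
qed

text \<open>The remainder \<open>R\<close> is diagonal with zeros before \<open>k\<close> and the
  tail of the singular values from \<open>k\<close> on, and multiplying by \<open>U\<close> and by
  the adjoint of \<open>V\<close> preserves the norm. It therefore suffices to bound the tail by
  \<open>C\<close>.\<close>

lemma eckart_young:
  assumes U: "U \<in> carrier_mat m m" and S: "S \<in> carrier_mat m p" and V: "V \<in> carrier_mat p p"
    and iso: "mat_adjoint U * U = 1\<^sub>m m" "mat_adjoint V * V = (1\<^sub>m p :: 'f::rc_scalar mat)"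
      "V * mat_adjoint V = 1\<^sub>m p"
    and diag: "diagonal_mat S"
    and mono: "\<And>i j. i \<le> j \<Longrightarrow> j < min m p \<Longrightarrow> norm (S $$ (j, j)) \<le> norm (S $$ (i, i))"
    and B: "B \<in> carrier_mat m p"
    and ker: "\<And>W. W \<in> carrier_mat p (Suc k) \<Longrightarrow>
      \<exists>c\<in>carrier_vec (Suc k). c \<noteq> 0\<^sub>v (Suc k) \<and> (B * W) *\<^sub>v c = 0\<^sub>v m"
    and C: "0 \<le> C"
    and bound: "\<And>w. w \<in> carrier_vec p \<Longrightarrow>
      sqnorm ((U * S * mat_adjoint V - B) *\<^sub>v w) \<le> C\<^sup>2 * sqnorm w"
    and v: "v \<in> carrier_vec p"
  shows "sqnorm ((U * S * mat_adjoint V - U * corner k S * mat_adjoint V) *\<^sub>v v) \<le> C\<^sup>2 * sqnorm v"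
proof -
  define R where "R = S - corner k S"
  have R: "R \<in> carrier_mat m p"
    unfolding R_def by (rule minus_carrier_mat[OF corner_carrier[OF S]])
  have R_diag: "diagonal_mat R"
    using diag S by (auto simp: diagonal_mat_def R_def corner_def)
  \<comment> \<open>A tail entry is at most entry \<open>k\<close>, to which the kernel argument
    applies. The tail index itself witnesses \<open>k < min m p\<close>; for \<open>k\<close> beyond
    the diagonal there is no tail.\<close>
  have R_le: "norm (R $$ (i, i)) \<le> C" if "i < min m p" for i
  proof (cases "i < k")
    case True
    then show ?thesis
      using S that C by (simp add: R_def corner_def)
  next
    case False
    then have "norm (S $$ (i, i)) \<le> norm (S $$ (k, k))"
      using that by (intro mono) auto
    also have "\<dots> \<le> C"
      using False that by (intro tail_le_of_kernel[OF U S V iso(1,2) diag mono _ _ B ker C bound]) auto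
    finally show ?thesis
      using S that False by (simp add: R_def corner_def)
  qed
  define z where "z = mat_adjoint V *\<^sub>v v"
  have z: "z \<in> carrier_vec p"
    unfolding z_def by (rule mult_mat_vec_carrier[OF mat_adjoint_carrier[OF V] v])
  have "U * S * mat_adjoint V - U * corner k S * mat_adjoint V = (U * S - U * corner k S) * mat_adjoint V"
    using U S V
    by (intro minus_mult_distrib_mat[symmetric, of _ m p _ _ p]) (auto intro!: mult_carrier_mat)
  also have "U * S - U * corner k S = U * R"
    unfolding R_def by (rule mult_minus_distrib_mat[symmetric, OF U S corner_carrier[OF S]])
  finally have "(U * S * mat_adjoint V - U * corner k S * mat_adjoint V) *\<^sub>v v = U *\<^sub>v (R *\<^sub>v z)"
    using U R V v by (simp add: z_def mult_mat_mat_vec)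
  then have "sqnorm ((U * S * mat_adjoint V - U * corner k S * mat_adjoint V) *\<^sub>v v) = sqnorm (R *\<^sub>v z)"
    using sqnorm_isometry[OF U _ iso(1), of "R *\<^sub>v z"] R z by simp
  also have "\<dots> \<le> C\<^sup>2 * sqnorm z"
    by (rule sqnorm_diagonal_le[OF R R_diag z R_le])
  \<comment> \<open>\<open>iso(3)\<close> says that the adjoint of \<open>V\<close> is an
    isometry.\<close>
  also have "sqnorm z = sqnorm v"
    unfolding z_def using V v iso(3) by (intro sqnorm_isometry[of _ p p]) auto
  finally show ?thesis .
qed


section \<open>Quasitubes as bounded sequences\<close>

lemma bounded_range_iff: "bounded (range f) \<longleftrightarrow> (\<exists>K. \<forall>k. norm (f k) \<le> K)"
  by (simp add: bounded_iff)

lemma bounded_range_add: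
  fixes f g :: "'k \<Rightarrow> 'a::real_normed_vector"
  assumes "bounded (range f)" "bounded (range g)"
  shows "bounded (range (\<lambda>k. f k + g k))"
proof -
  obtain a b where a: "\<forall>k. norm (f k) \<le> a" and b: "\<forall>k. norm (g k) \<le> b"
    using assms unfolding bounded_range_iff by blast
  have "norm (f k + g k) \<le> a + b" for k
    by (rule order_trans[OF norm_triangle_ineq add_mono]) (simp_all add: a b)
  then show ?thesis
    unfolding bounded_range_iff by blast
qed

lemma bounded_range_sum:
  fixes f :: "'i \<Rightarrow> 'k \<Rightarrow> 'a::real_normed_vector"
  assumes "\<And>i. i \<in> I \<Longrightarrow> bounded (range (f i))"
  shows "bounded (range (\<lambda>k. \<Sum>i\<in>I. f i k))"
  using assms
  by (induction I rule: infinite_finite_induct) (simp_all add: bounded_range_add)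

lemma bounded_range_mult:
  fixes f g :: "'k \<Rightarrow> 'a::real_normed_algebra"
  assumes "bounded (range f)" "bounded (range g)"
  shows "bounded (range (\<lambda>k. f k * g k))"
proof -
  obtain a b where a: "\<forall>k. norm (f k) \<le> a" and b: "\<forall>k. norm (g k) \<le> b"
    using assms unfolding bounded_range_iff by blast
  have "norm (f k * g k) \<le> a * b" for k
    by (rule order_trans[OF norm_mult_ineq mult_mono']) (simp_all add: a b)
  then show ?thesis
    unfolding bounded_range_iff by blast
qed

text \<open>These are exactly the slice families of tensors. Closure under products, adjoints and
  corners guarantees that \<open>of_slices\<close>, built from \<open>inv_into\<close>, returns
  tensors with the prescribed slices.\<close>

definition bounded_slices :: "nat \<Rightarrow> nat \<Rightarrow> (int \<Rightarrow> 'a::real_normed_vector mat) \<Rightarrow> bool" where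
  "bounded_slices m p A \<longleftrightarrow> (\<forall>k. A k \<in> carrier_mat m p) \<and>
    (\<forall>i<m. \<forall>j<p. bounded (range (\<lambda>k. A k $$ (i, j))))"

lemma bounded_slices_carrier: "bounded_slices m p A \<Longrightarrow> A k \<in> carrier_mat m p"
  by (simp add: bounded_slices_def)

lemma bounded_slices_mult:
  fixes A B :: "int \<Rightarrow> 'f::rc_scalar mat"
  assumes A: "bounded_slices m n A" and B: "bounded_slices n p B"
  shows "bounded_slices m p (\<lambda>k. A k * B k)"
proof -
  have "A k \<in> carrier_mat m n" "B k \<in> carrier_mat n p" for k
    using A B by (simp_all add: bounded_slices_def)
  note car = this
  have "bounded (range (\<lambda>k. (A k * B k) $$ (i, j)))" if "i < m" "j < p" for i j
    unfolding index_mult_mat_sum[OF car that]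
    using A B that
    by (intro bounded_range_sum bounded_range_mult) (auto simp: bounded_slices_def)
  with car show ?thesis
    by (auto simp: bounded_slices_def intro: mult_carrier_mat)
qed

lemma bounded_slices_adjoint:
  fixes A :: "int \<Rightarrow> 'f::rc_scalar mat"
  assumes "bounded_slices m n A"
  shows "bounded_slices n m (\<lambda>k. mat_adjoint (A k))"
proof -
  have car: "A k \<in> carrier_mat m n" for k
    using assms by (simp add: bounded_slices_def)
  have "bounded (range (\<lambda>k. mat_adjoint (A k) $$ (i, j)))" if "i < n" "j < m" for i j
  proof -
    have "mat_adjoint (A k) $$ (i, j) = conjugate (A k $$ (j, i))" for k
      using car[of k] that by simp
    moreover have "bounded (range (\<lambda>k. A k $$ (j, i)))"
      using assms that by (simp add: bounded_slices_def)
    ultimately show ?thesis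
      by (simp add: bounded_iff)
  qed
  with car show ?thesis
    by (simp add: bounded_slices_def)
qed

text \<open>The cut-off may vary arbitrarily with \<open>k\<close>, since each entry is either kept
  or set to zero and so obeys the old bound.\<close>

lemma bounded_slices_corner:
  assumes "bounded_slices m n A"
  shows "bounded_slices m n (\<lambda>k. corner (r k) (A k))"
proof -
  have car: "A k \<in> carrier_mat m n" for k
    using assms by (simp add: bounded_slices_def)
  have "bounded (range (\<lambda>k. corner (r k) (A k) $$ (i, j)))" if "i < m" "j < n" for i j
  proof -
    have "norm (corner (r k) (A k) $$ (i, j)) \<le> norm (A k $$ (i, j))" for k
      using car[of k] that by (simp add: corner_def)
    moreover have "bounded (range (\<lambda>k. A k $$ (i, j)))"
      using assms that by (simp add: bounded_slices_def)
    then obtain K where "\<forall>k. norm (A k $$ (i, j)) \<le> K"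
      unfolding bounded_range_iff by blast
    ultimately have "norm (corner (r k) (A k) $$ (i, j)) \<le> K" for k
      using order_trans by blast
    then show ?thesis
      unfolding bounded_range_iff by blast
  qed
  with car show ?thesis
    by (simp add: bounded_slices_def)
qed

lemma hvec_norm_eq: "hvec_norm v = sqrt (sqnorm v)"
  by (simp add: hvec_norm_def sqnorm_def)

lemma hvec_norm_power2: "(hvec_norm v)\<^sup>2 = sqnorm v"
  by (simp add: hvec_norm_eq sqnorm_nonneg)

lemma has_sum_sum_family:
  fixes f :: "'i \<Rightarrow> 'k \<Rightarrow> 'a::topological_comm_monoid_add"
  assumes "\<And>i. i \<in> I \<Longrightarrow> (f i has_sum s i) A"
  shows "((\<lambda>k. \<Sum>i\<in>I. f i k) has_sum (\<Sum>i\<in>I. s i)) A"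
  using assms
  by (induction I rule: infinite_finite_induct) (simp_all add: has_sum_add)

context based_hilbert_space
begin

section \<open>Quasitubes as coordinate multipliers\<close>

lemma star_bas: "star H (bas H k) x = scl H (coord H x k) (bas H k)"
  by (rule coord_eqI) (simp add: coord_bas coord_scl)

lemma star_zero_left: "star H 0 x = 0"
  by (rule coord_eqI) simp

lemma quasitube_star:
  assumes "q \<in> quasitubes H"
  shows "q (star H a x) = star H a (q x)"
proof -
  \<comment> \<open>H-linearity with the second summand made trivial by the factor 0.\<close>
  have "q (star H a x + star H 0 0) = star H a (q x) + star H 0 (q 0)"
    using assms unfolding quasitubes_def H_linear_def by blast
  then show ?thesis
    by (simp add: star_zero_left)
qed

text \<open>The component \<open>?y\<close> of \<open>x\<close> along basis vector \<open>k\<close>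
  equals both \<open>star H ?y (bas H k)\<close> and \<open>star H (bas H k) x\<close>. Pulling the
  first factor out of \<open>q\<close> in each form and comparing coordinate \<open>k\<close> gives
  the claim.\<close>

lemma coord_quasitube:
  assumes "q \<in> quasitubes H"
  shows "coord H (q x) k = qt_pi H q k * coord H x k"
proof -
  let ?y = "scl H (coord H x k) (bas H k)"
  have "star H ?y (bas H k) = ?y"
    by (rule coord_eqI) (simp add: coord_bas coord_scl)
  then have "coord H (q ?y) k = coord H x k * qt_pi H q k"
    using quasitube_star[OF assms, of ?y "bas H k"]
    by (simp add: coord_scl coord_bas) (simp add: coord_def qt_pi_def)
  moreover have "q ?y = star H (bas H k) (q x)"
    using quasitube_star[OF assms, of "bas H k" x] by (simp add: star_bas)
  ultimately show ?thesis
    by (simp add: coord_bas)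
qed

lemma bounded_qt_pi:
  assumes "q \<in> quasitubes H"
  shows "bounded (range (qt_pi H q))"
proof -
  obtain K where K: "\<And>x. norm (q x) \<le> K * norm x"
    using assms unfolding quasitubes_def by blast
  have "norm (qt_pi H q k) \<le> K" for k
    using norm_coord_le[of "q (bas H k)" k] K[of "bas H k"] by (simp add: qt_pi_def coord_def)
  then show ?thesis
    unfolding bounded_range_iff by blast
qed

lemma quasitubeI:
  assumes "bounded (range c)" and c: "\<And>x k. coord H (q x) k = c k * coord H x k"
  shows "q \<in> quasitubes H" and "qt_pi H q = c"
proof -
  obtain K where "\<forall>k. norm (c k) \<le> K"
    using assms(1) unfolding bounded_range_iff by blast
  then have K: "norm (c k) \<le> K" for k
    by simp
  have "0 \<le> K"
    using order_trans[OF norm_ge_zero K] by simp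
  have "H_linear H q"
    unfolding H_linear_def by (intro allI coord_eqI) (simp add: c coord_add algebra_simps)
  moreover have "norm (q x) \<le> K * norm x" for x
    by (rule norm_le_of_coord_mult[OF K \<open>0 \<le> K\<close> c])
  ultimately show "q \<in> quasitubes H"
    unfolding quasitubes_def by blast
  show "qt_pi H q = c"
  proof
    fix k
    show "qt_pi H q k = c k"
      using c[of "bas H k" k] by (simp add: qt_pi_def coord_def bas_orthonormal)
  qed
qed

text \<open>The preimage is multiplication by \<open>c\<close>, chosen pointwise;
  \<open>exists_coord_mult\<close>, and so completeness, provides the values.\<close>

lemma qt_pi_surj:
  assumes "bounded (range c)"
  shows "c \<in> qt_pi H ` quasitubes H"
proof -
  obtain K where "\<forall>k. norm (c k) \<le> K"
    using assms unfolding bounded_range_iff by blast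
  then have K: "norm (c k) \<le> K" for k
    by simp
  define q where "q x = (SOME z. \<forall>k. coord H z k = c k * coord H x k)" for x
  have "coord H (q x) k = c k * coord H x k" for x k
  proof -
    have "\<exists>z. \<forall>k. coord H z k = c k * coord H x k"
      using exists_coord_mult[of c K, OF K] by metis
    from someI_ex[OF this] show ?thesis
      by (simp add: q_def)
  qed
  from quasitubeI[OF assms this] show ?thesis
    by blast
qed

lemma quasitube_diff:
  assumes "a \<in> quasitubes H" "b \<in> quasitubes H"
  shows "a - b \<in> quasitubes H" and "qt_pi H (a - b) k = qt_pi H a k - qt_pi H b k"
proof -
  have b: "bounded (range (\<lambda>k. qt_pi H a k - qt_pi H b k))"
    using bounded_range_add[of "qt_pi H a" "\<lambda>k. - qt_pi H b k"] bounded_qt_pi assms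
    by (simp add: bounded_iff)
  have c: "coord H ((a - b) x) k = (qt_pi H a k - qt_pi H b k) * coord H x k" for x k
    by (simp add: coord_diff coord_quasitube assms left_diff_distrib)
  show "a - b \<in> quasitubes H"
    by (rule quasitubeI(1)[OF b c])
  show "qt_pi H (a - b) k = qt_pi H a k - qt_pi H b k"
    by (rule fun_cong[OF quasitubeI(2)[OF b c]])
qed

lemma quasitube_zero: "(\<lambda>x. 0) \<in> quasitubes H"
  by (rule quasitubeI(1)[of "\<lambda>k. 0"]) (simp_all add: image_constant_conv)

lemma qt_pi_zero: "qt_pi H (\<lambda>x. 0) k = 0"
  by (simp add: qt_pi_def)

lemma qt_pi_id: "qt_pi H id k = 1"
  by (simp add: qt_pi_def bas_orthonormal)

lemma quasitube_apply_bas: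
  assumes "q \<in> quasitubes H"
  shows "q (bas H k) = scl H (qt_pi H q k) (bas H k)"
  by (rule coord_eqI) (simp add: coord_quasitube[OF assms] coord_scl coord_bas)

text \<open>Basis vector \<open>k\<close> is an eigenvector of the difference of \<open>a\<close>
  and \<open>b\<close>, with the difference of the entries as eigenvalue. An eigenvalue lies in the
  spectrum, which the order places in the nonnegative reals.\<close>

lemma qt_ge_imp_qt_pi:
  assumes "qt_ge H a b" "a \<in> quasitubes H" "b \<in> quasitubes H"
  obtains t where "0 \<le> t" "qt_pi H a k - qt_pi H b k = of_real t"
proof -
  let ?z = "qt_pi H a k - qt_pi H b k"
  let ?q = "\<lambda>x. (a x - b x) - scl H ?z x"
  have "\<not> qt_invertible H ?q"
  proof
    assume "qt_invertible H ?q"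
    then obtain c where c: "c \<in> quasitubes H" "c \<circ> ?q = id"
      unfolding qt_invertible_def by blast
    have "?q (bas H k) = 0"
      using assms(2,3) by (simp add: quasitube_apply_bas scale_left_diff_distrib)
    moreover have "c 0 = 0"
      by (rule coord_eqI) (simp add: coord_quasitube[OF c(1)])
    ultimately have "bas H k = 0"
      using fun_cong[OF c(2), of "bas H k"] by simp
    then show False
      using norm_bas[of k] by simp
  qed
  then have "?z \<in> qt_spectrum H (\<lambda>x. a x - b x)"
    by (simp add: qt_spectrum_def)
  with assms(1) have "?z \<in> of_real ` {0..}"
    unfolding qt_ge_def by blast
  then show ?thesis
    using that by auto
qed

section \<open>Tensors and their slices\<close>

lemma qtensors_index: "X \<in> qtensors H m p \<Longrightarrow> i < m \<Longrightarrow> j < p \<Longrightarrow> X $$ (i, j) \<in> quasitubes H"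
  unfolding qtensors_def elements_mat_def by fastforce

lemma bounded_slices_slice:
  assumes "X \<in> qtensors H m p"
  shows "bounded_slices m p (slice H X)"
proof -
  have "X $$ (i, j) \<in> quasitubes H" if "i < m" "j < p" for i j
    using assms that by (auto intro: qtensors_index)
  then show ?thesis
    using assms bounded_qt_pi by (auto simp: bounded_slices_def slice_def qtensors_def)
qed

lemma slice_carrier: "X \<in> qtensors H m p \<Longrightarrow> slice H X k \<in> carrier_mat m p"
  by (simp add: slice_def qtensors_def)

text \<open>\<open>inv_into\<close> is a right inverse only on the image of \<open>qt_pi\<close>;
  \<open>qt_pi_surj\<close> puts every bounded entry sequence there.\<close>

lemma of_slices_qtensors:
  assumes "bounded_slices m p A"
  shows "of_slices H m p A \<in> qtensors H m p" and "slice H (of_slices H m p A) k = A k"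
proof -
  have surj: "(\<lambda>k. A k $$ (i, j)) \<in> qt_pi H ` quasitubes H" if "i < m" "j < p" for i j
    using assms that by (intro qt_pi_surj) (simp add: bounded_slices_def)
  show "of_slices H m p A \<in> qtensors H m p"
    using inv_into_into[OF surj] by (auto simp: qtensors_def of_slices_def elements_mat_def)
  show "slice H (of_slices H m p A) k = A k"
    using bounded_slices_carrier[OF assms, of k]
    by (intro eq_matI) (auto simp: slice_def of_slices_def f_inv_into_f[OF surj])
qed

lemma qt_times_qtensors:
  assumes X: "X \<in> qtensors H m n" and Y: "Y \<in> qtensors H n p"
  shows "qt_times H X Y \<in> qtensors H m p"
    and "slice H (qt_times H X Y) k = slice H X k * slice H Y k"
proof -
  note b = bounded_slices_mult[OF bounded_slices_slice[OF X] bounded_slices_slice[OF Y]]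
  have "dim_row X = m" "dim_col Y = p"
    using X Y by (auto simp: qtensors_def)
  with of_slices_qtensors[OF b]
  show "qt_times H X Y \<in> qtensors H m p"
    and "slice H (qt_times H X Y) k = slice H X k * slice H Y k"
    by (simp_all add: qt_times_def)
qed

lemma qt_adjoint_qtensors:
  assumes X: "X \<in> qtensors H m n"
  shows "qt_adjoint H X \<in> qtensors H n m"
    and "slice H (qt_adjoint H X) k = mat_adjoint (slice H X k)"
proof -
  note b = bounded_slices_adjoint[OF bounded_slices_slice[OF X]]
  have "dim_row X = m" "dim_col X = n"
    using X by (auto simp: qtensors_def)
  with of_slices_qtensors[OF b]
  show "qt_adjoint H X \<in> qtensors H n m"
    and "slice H (qt_adjoint H X) k = mat_adjoint (slice H X k)"
    by (simp_all add: qt_adjoint_def)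
qed

lemma slice_identity: "slice H (qt_identity n) k = 1\<^sub>m n"
  by (rule eq_matI) (auto simp: slice_def qt_identity_def qt_pi_zero qt_pi_id)

lemma qt_unitary_slice:
  assumes "qt_unitary H n U"
  shows "mat_adjoint (slice H U k) * slice H U k = 1\<^sub>m n"
    and "slice H U k * mat_adjoint (slice H U k) = 1\<^sub>m n"
proof -
  have U: "U \<in> qtensors H n n" and eq: "qt_times H (qt_adjoint H U) U = qt_identity n"
    "qt_times H U (qt_adjoint H U) = qt_identity n"
    using assms by (simp_all add: qt_unitary_def)
  note U' = qt_adjoint_qtensors[OF U]
  show "mat_adjoint (slice H U k) * slice H U k = 1\<^sub>m n"
    using arg_cong[OF eq(1), of "\<lambda>Z. slice H Z k"]
    by (simp add: qt_times_qtensors(2)[OF U'(1) U] U'(2) slice_identity)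
  show "slice H U k * mat_adjoint (slice H U k) = 1\<^sub>m n"
    using arg_cong[OF eq(2), of "\<lambda>Z. slice H Z k"]
    by (simp add: qt_times_qtensors(2)[OF U U'(1)] U'(2) slice_identity)
qed

lemma qtensors_minus:
  assumes X: "X \<in> qtensors H m p" and Y: "Y \<in> qtensors H m p"
  shows "X - Y \<in> qtensors H m p" and "slice H (X - Y) k = slice H X k - slice H Y k"
proof -
  have q: "X $$ (i, j) \<in> quasitubes H" "Y $$ (i, j) \<in> quasitubes H" if "i < m" "j < p" for i j
    using assms that by (auto intro: qtensors_index)
  have car: "X \<in> carrier_mat m p" "Y \<in> carrier_mat m p"
    using assms by (simp_all add: qtensors_def)
  then show "X - Y \<in> qtensors H m p"
    using q quasitube_diff(1) by (auto simp: qtensors_def elements_mat_def)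
  show "slice H (X - Y) k = slice H X k - slice H Y k"
    using car q quasitube_diff(2) by (intro eq_matI) (auto simp: slice_def)
qed


section \<open>The operator norm in terms of slices\<close>

lemma hvec_parseval:
  "((\<lambda>k. sqnorm (map_vec (\<lambda>x. coord H x k) v)) has_sum sqnorm v) UNIV"
proof -
  have "((\<lambda>k. \<Sum>i<dim_vec v. (norm (coord H (v $ i) k))\<^sup>2) has_sum sqnorm v) UNIV"
    unfolding sqnorm_def by (intro has_sum_sum_family parseval)
  then show ?thesis
    by (simp add: sqnorm_def)
qed

lemma coord_qt_apply:
  assumes B: "B \<in> qtensors H m p" and v: "v \<in> carrier_vec p"
  shows "map_vec (\<lambda>x. coord H x k) (qt_apply B v) = slice H B k *\<^sub>v map_vec (\<lambda>x. coord H x k) v"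
proof (rule eq_vecI)
  have car: "B \<in> carrier_mat m p"
    using B by (simp add: qtensors_def)
  fix i
  assume "i < dim_vec (slice H B k *\<^sub>v map_vec (\<lambda>x. coord H x k) v)"
  then have i: "i < m"
    using car by (simp add: slice_def)
  have q: "B $$ (i, j) \<in> quasitubes H" if "j < p" for j
    using B i that by (rule qtensors_index)
  have "(slice H B k *\<^sub>v map_vec (\<lambda>x. coord H x k) v) $ i
      = (\<Sum>j<p. slice H B k $$ (i, j) * map_vec (\<lambda>x. coord H x k) v $ j)"
    using slice_carrier[OF B] v i by (intro index_mult_mat_vec_sum) auto
  also have "\<dots> = (\<Sum>j<p. coord H ((B $$ (i, j)) (v $ j)) k)"
    using car v i by (intro sum.cong) (auto simp: slice_def coord_quasitube[OF q])
  finally show "map_vec (\<lambda>x. coord H x k) (qt_apply B v) $ i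
      = (slice H B k *\<^sub>v map_vec (\<lambda>x. coord H x k) v) $ i"
    using car i by (simp add: qt_apply_def coord_sum)
qed (use B in \<open>auto simp: qt_apply_def slice_def qtensors_def\<close>)

lemma hvec_norm_qt_apply_le:
  assumes B: "B \<in> qtensors H m p" and v: "v \<in> carrier_vec p" and C: "0 \<le> C"
    and bound: "\<And>k w. w \<in> carrier_vec p \<Longrightarrow> sqnorm (slice H B k *\<^sub>v w) \<le> C\<^sup>2 * sqnorm w"
  shows "hvec_norm (qt_apply B v) \<le> C * hvec_norm v"
proof -
  have "sqnorm (qt_apply B v) \<le> C\<^sup>2 * sqnorm v"
  proof (rule has_sum_mono[OF hvec_parseval has_sum_cmult_right[OF hvec_parseval]])
    fix k
    show "sqnorm (map_vec (\<lambda>x. coord H x k) (qt_apply B v))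
        \<le> C\<^sup>2 * sqnorm (map_vec (\<lambda>x. coord H x k) v)"
      unfolding coord_qt_apply[OF B v] using v by (intro bound) auto
  qed
  then have "hvec_norm (qt_apply B v) \<le> sqrt (C\<^sup>2 * sqnorm v)"
    unfolding hvec_norm_eq by (rule real_sqrt_le_mono)
  then show ?thesis
    using C by (simp add: real_sqrt_mult hvec_norm_eq)
qed

text \<open>Makes the set under the supremum in \<open>op_norm\<close> nonempty, as a supremum of
  reals requires.\<close>

lemma exists_unit_hvec:
  assumes "0 < p"
  obtains v where "v \<in> carrier_vec p" "hvec_norm (v :: 'h vec) = 1"
proof
  let ?v = "vec p (\<lambda>j. if j = 0 then bas H 0 else 0)"
  show "?v \<in> carrier_vec p"
    by simp
  have "sqnorm ?v = (\<Sum>i<p. if i = 0 then 1 else 0)"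
    unfolding sqnorm_def by (intro sum.cong) auto
  then show "hvec_norm ?v = 1"
    using assms by (simp add: hvec_norm_eq)
qed

lemma op_norm_le:
  assumes B: "B \<in> qtensors H m p" and p: "0 < p" and C: "0 \<le> C"
    and bound: "\<And>k w. w \<in> carrier_vec p \<Longrightarrow> sqnorm (slice H B k *\<^sub>v w) \<le> C\<^sup>2 * sqnorm w"
  shows "op_norm B \<le> C"
  unfolding op_norm_def
proof (rule cSup_least)
  have dim: "dim_col B = p"
    using B by (auto simp: qtensors_def)
  show "{hvec_norm (qt_apply B v) |v. v \<in> carrier_vec (dim_col B) \<and> hvec_norm v = 1} \<noteq> {}"
    unfolding dim using exists_unit_hvec[OF p] by blast
  fix t
  assume "t \<in> {hvec_norm (qt_apply B v) |v. v \<in> carrier_vec (dim_col B) \<and> hvec_norm v = 1}"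
  then obtain v where "v \<in> carrier_vec p" "hvec_norm v = 1" "t = hvec_norm (qt_apply B v)"
    unfolding dim by blast
  with hvec_norm_qt_apply_le[OF B _ C bound, of v] show "t \<le> C"
    by simp
qed

text \<open>A supremum of reals is sure to dominate its elements only for sets bounded above; a
  crude bound from the entrywise constants is enough.\<close>

lemma bdd_above_op_norm:
  assumes B: "B \<in> qtensors H m p"
  shows "bdd_above {hvec_norm (qt_apply B v) |v. v \<in> carrier_vec (dim_col B) \<and> hvec_norm v = 1}"
proof -
  have car: "B \<in> carrier_mat m p"
    using B by (simp add: qtensors_def)
  have "\<exists>K. \<forall>x. norm ((B $$ (i, j)) x) \<le> K * norm x" if "i < m" "j < p" for i j
  proof -
    have "B $$ (i, j) \<in> quasitubes H"
      using B that by (rule qtensors_index)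
    then show ?thesis
      by (simp add: quasitubes_def)
  qed
  then obtain K where K: "\<And>i j x. i < m \<Longrightarrow> j < p \<Longrightarrow> norm ((B $$ (i, j)) x) \<le> K i j * norm x"
    by metis
  have "hvec_norm (qt_apply B v) \<le> sqrt (\<Sum>i<m. (\<Sum>j<p. \<bar>K i j\<bar>)\<^sup>2)"
    if v: "v \<in> carrier_vec p" "hvec_norm v = 1" for v
  proof -
    have v_le: "norm (v $ j) \<le> 1" if "j < p" for j
    proof -
      have "(norm (v $ j))\<^sup>2 \<le> sqnorm v"
        unfolding sqnorm_def using v(1) that by (intro member_le_sum) auto
      also have "\<dots> = 1\<^sup>2"
        using v(2) by (simp add: hvec_norm_power2[symmetric])
      finally show ?thesis
        by (rule power2_le_imp_le) simp
    qed
    have "norm (\<Sum>j<p. (B $$ (i, j)) (v $ j)) \<le> (\<Sum>j<p. \<bar>K i j\<bar>)" if "i < m" for i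
    proof (rule sum_norm_le)
      fix j
      assume "j \<in> {..<p}"
      then have j: "j < p" by simp
      have "norm ((B $$ (i, j)) (v $ j)) \<le> K i j * norm (v $ j)"
        by (rule K[OF that j])
      \<comment> \<open>The constants carry no sign condition, hence the absolute value before
        \<open>norm (v $ j)\<close> is enlarged to 1.\<close>
      also have "\<dots> \<le> \<bar>K i j\<bar> * 1"
        using v_le[OF j] by (intro mult_mono) auto
      finally show "norm ((B $$ (i, j)) (v $ j)) \<le> \<bar>K i j\<bar>"
        by simp
    qed
    then show ?thesis
      unfolding hvec_norm_def using car
      by (intro real_sqrt_le_mono) (auto simp: qt_apply_def intro!: sum_mono power_mono)
  qed
  then show ?thesis
    using car by (intro bdd_aboveI) auto
qed

lemma op_norm_nonneg:
  assumes B: "B \<in> qtensors H m p" and p: "0 < p"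
  shows "0 \<le> op_norm B"
proof -
  have "dim_col B = p"
    using B by (auto simp: qtensors_def)
  then obtain v where "v \<in> carrier_vec (dim_col B)" "hvec_norm (v :: 'h vec) = 1"
    using exists_unit_hvec[OF p] by metis
  then have "hvec_norm (qt_apply B v) \<le> op_norm B"
    unfolding op_norm_def by (intro cSup_upper bdd_above_op_norm[OF B]) blast
  then show ?thesis
    using sqnorm_nonneg[of "qt_apply B v"] by (simp add: hvec_norm_eq order_trans[OF real_sqrt_ge_zero])
qed

text \<open>A slice is isolated by testing on vectors whose components are all multiples of one
  basis vector.\<close>

lemma slice_le_op_norm:
  assumes B: "B \<in> qtensors H m p" and w: "w \<in> carrier_vec p"
  shows "sqnorm (slice H B k *\<^sub>v w) \<le> (op_norm B)\<^sup>2 * sqnorm w"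
proof (cases "w = 0\<^sub>v p")
  case True
  have "slice H B k *\<^sub>v w = 0\<^sub>v m"
    using slice_carrier[OF B, of k] True by auto
  with True show ?thesis
    by (simp add: sqnorm_def)
next
  case False
  have car: "B \<in> carrier_mat m p"
    using B by (simp add: qtensors_def)
  define s where "s = sqrt (sqnorm w)"
  have s: "0 < s"
    using sqnorm_pos[OF w False] by (simp add: s_def)
  have s2: "s\<^sup>2 = sqnorm w"
    by (simp add: s_def sqnorm_nonneg)
  \<comment> \<open>The entries of \<open>w\<close>, divided by its length \<open>s\<close>, are
    placed along basis vector \<open>k\<close>. This gives a unit vector whose \<open>k\<close>-th
    coordinates form \<open>w\<close> scaled by \<open>inverse s\<close>.\<close>
  define v where "v = map_vec (\<lambda>a. scl H (of_real (inverse s) * a) (bas H k)) w"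
  have v: "v \<in> carrier_vec p"
    using w by (simp add: v_def)
  have "sqnorm v = (\<Sum>i<p. (inverse s)\<^sup>2 * (norm (w $ i))\<^sup>2)"
    unfolding sqnorm_def using w
    by (intro sum.cong) (auto simp: v_def norm_scl norm_mult norm_inverse power_mult_distrib power_inverse)
  also have "\<dots> = (inverse s)\<^sup>2 * sqnorm w"
    using w by (simp add: sqnorm_def sum_distrib_left)
  also have "\<dots> = 1"
    using s by (simp add: s2[symmetric] power_inverse)
  finally have v1: "hvec_norm v = 1"
    by (simp add: hvec_norm_eq)
  have cv: "map_vec (\<lambda>x. coord H x k) v = of_real (inverse s) \<cdot>\<^sub>v w"
    by (rule eq_vecI) (auto simp: v_def coord_scl coord_bas)
  have "(inverse s)\<^sup>2 * sqnorm (slice H B k *\<^sub>v w) = sqnorm (of_real (inverse s) \<cdot>\<^sub>v (slice H B k *\<^sub>v w))"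
    by (simp add: sqnorm_def sum_distrib_left norm_mult norm_inverse power_mult_distrib power_inverse)
  also have "of_real (inverse s) \<cdot>\<^sub>v (slice H B k *\<^sub>v w) = map_vec (\<lambda>x. coord H x k) (qt_apply B v)"
    unfolding coord_qt_apply[OF B v] cv
    using mult_mat_vec[OF slice_carrier[OF B] w] by simp
  also have "sqnorm \<dots> \<le> sqnorm (qt_apply B v)"
    unfolding sqnorm_def by (auto intro!: sum_mono power_mono norm_coord_le)
  also have "\<dots> = (hvec_norm (qt_apply B v))\<^sup>2"
    by (simp add: hvec_norm_power2)
  also have "\<dots> \<le> (op_norm B)\<^sup>2"
  proof (rule power_mono)
    show "hvec_norm (qt_apply B v) \<le> op_norm B"
      unfolding op_norm_def using v v1 car by (intro cSup_upper bdd_above_op_norm[OF B]) auto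
  qed (simp add: hvec_norm_eq sqnorm_nonneg)
  finally have "(inverse s)\<^sup>2 * sqnorm (slice H B k *\<^sub>v w) \<le> (op_norm B)\<^sup>2" .
  then show ?thesis
    using s by (simp add: s2[symmetric] power_inverse field_simps)
qed


section \<open>Truncations and ranks\<close>

lemma q_svdD:
  assumes "q_svd H m p X U S V"
  shows "U \<in> qtensors H m m" "S \<in> qtensors H m p" "V \<in> qtensors H p p"
    and "diagonal_mat (slice H S k)"
    and "slice H X k = slice H U k * slice H S k * mat_adjoint (slice H V k)"
proof -
  show U: "U \<in> qtensors H m m" and S: "S \<in> qtensors H m p" and V: "V \<in> qtensors H p p"
    using assms by (simp_all add: q_svd_def qt_unitary_def)
  show "diagonal_mat (slice H S k)"
    using assms by (simp add: q_svd_def f_diagonal_def)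
  have "X = qt_times H (qt_times H U S) (qt_adjoint H V)"
    using assms by (simp add: q_svd_def)
  then show "slice H X k = slice H U k * slice H S k * mat_adjoint (slice H V k)"
    by (simp add: qt_times_qtensors(2)[OF qt_times_qtensors(1)[OF U S] qt_adjoint_qtensors(1)[OF V]]
        qt_times_qtensors(2)[OF U S] qt_adjoint_qtensors(2)[OF V])
qed

text \<open>The order on quasitubes compares entries as reals, and nonnegativity of the smaller one
  turns this into a comparison of norms. The q-SVD orders neighbours only, hence the
  induction.\<close>

lemma singular_values_antimono:
  assumes svd: "q_svd H m p X U S V" and "i \<le> j" "j < min m p"
  shows "norm (slice H S k $$ (j, j)) \<le> norm (slice H S k $$ (i, i))"
proof -
  have S: "S \<in> qtensors H m p"
    by (rule q_svdD(2)[OF svd])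
  have index: "slice H S k $$ (i, i) = qt_pi H (S $$ (i, i)) k" if "i < min m p" for i
    using S that by (auto simp: slice_def qtensors_def)
  have q: "S $$ (i, i) \<in> quasitubes H" if "i < min m p" for i
    using that by (intro qtensors_index[OF S]) auto
  have adjacent: "norm (slice H S k $$ (Suc i, Suc i)) \<le> norm (slice H S k $$ (i, i))"
    if i: "Suc i < min m p" for i
  proof -
    have "qt_ge H (S $$ (i, i)) (S $$ (Suc i, Suc i))" "qt_ge H (S $$ (Suc i, Suc i)) (\<lambda>x. 0)"
      using svd i by (simp_all add: q_svd_def)
    \<comment> \<open>Entry \<open>Suc i\<close> is the real \<open>u\<close>, and entry
      \<open>i\<close> is \<open>t + u\<close>.\<close>
    then obtain t u where "0 \<le> t" "qt_pi H (S $$ (i, i)) k - qt_pi H (S $$ (Suc i, Suc i)) k = of_real t"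
      and "0 \<le> u" "qt_pi H (S $$ (Suc i, Suc i)) k - qt_pi H (\<lambda>x. 0) k = of_real u"
      using i q quasitube_zero by (metis Suc_lessD qt_ge_imp_qt_pi)
    then have "qt_pi H (S $$ (Suc i, Suc i)) k = of_real u" "qt_pi H (S $$ (i, i)) k = of_real (t + u)"
      by (simp_all add: qt_pi_zero diff_eq_eq)
    with \<open>0 \<le> t\<close> \<open>0 \<le> u\<close> i show ?thesis
      by (simp add: index del: of_real_add)
  qed
  from assms(2,3) show ?thesis
  proof (induction j rule: dec_induct)
    case (step j)
    then show ?case
      using adjacent[of j] by fastforce
  qed simp
qed

text \<open>The factors in the definition have sizes depending on \<open>k\<close>. Rewriting with
  \<open>corner\<close> gives factors of fixed size, for which boundedness in \<open>k\<close>
  follows from the closure rules.\<close>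

lemma multi_rank_trunc_slice:
  assumes U: "U \<in> qtensors H m m" and S: "S \<in> qtensors H m p" and V: "V \<in> qtensors H p p"
    and \<rho>: "\<And>k. \<rho> k \<le> min m p"
  shows "multi_rank_trunc H U S V \<rho> \<in> qtensors H m p"
    and "slice H (multi_rank_trunc H U S V \<rho>) k
      = slice H U k * corner (\<rho> k) (slice H S k) * mat_adjoint (slice H V k)"
proof -
  have b: "bounded_slices m p
      (\<lambda>k. slice H U k * corner (\<rho> k) (slice H S k) * mat_adjoint (slice H V k))"
    by (intro bounded_slices_mult[where n = p] bounded_slices_mult[where n = m] bounded_slices_corner
        bounded_slices_adjoint bounded_slices_slice U S V)
  have "dim_row S = m" "dim_col S = p"
    using S by (auto simp: qtensors_def)
  then have "multi_rank_trunc H U S V \<rho> = of_slices H m p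
      (\<lambda>k. slice H U k * corner (\<rho> k) (slice H S k) * mat_adjoint (slice H V k))"
    using \<rho> unfolding multi_rank_trunc_def
    by (simp add: truncated_product[OF slice_carrier[OF U] slice_carrier[OF S] slice_carrier[OF V]])
  with of_slices_qtensors[OF b]
  show "multi_rank_trunc H U S V \<rho> \<in> qtensors H m p"
    and "slice H (multi_rank_trunc H U S V \<rho>) k
      = slice H U k * corner (\<rho> k) (slice H S k) * mat_adjoint (slice H V k)"
    by simp_all
qed

text \<open>Common core of both claims. By \<open>op_norm_le\<close> it is enough to bound each
  slice with the constant \<open>op_norm (X - Y)\<close>, which \<open>slice_le_op_norm\<close>
  makes admissible for the Eckart-Young inequality in every slice.\<close>

lemma op_norm_multi_rank_trunc_le:
  assumes p: "0 < p" and X: "X \<in> qtensors H m p" and svd: "q_svd H m p X U S V"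
    and \<rho>: "\<And>k. \<rho> k \<le> min m p" and Y: "Y \<in> qtensors H m p"
    and ker: "\<And>k W. W \<in> carrier_mat p (Suc (\<rho> k)) \<Longrightarrow>
      \<exists>c\<in>carrier_vec (Suc (\<rho> k)). c \<noteq> 0\<^sub>v (Suc (\<rho> k)) \<and> (slice H Y k * W) *\<^sub>v c = 0\<^sub>v m"
  shows "op_norm (X - multi_rank_trunc H U S V \<rho>) \<le> op_norm (X - Y)"
proof -
  note svdD = q_svdD[OF svd]
  note trunc = multi_rank_trunc_slice[OF svdD(1-3), of \<rho>, OF \<rho>]
  have unitary: "qt_unitary H m U" "qt_unitary H p V"
    using svd by (simp_all add: q_svd_def)
  show ?thesis
  proof (rule op_norm_le[OF qtensors_minus(1)[OF X trunc(1)] p])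
    show "0 \<le> op_norm (X - Y)"
      by (rule op_norm_nonneg[OF qtensors_minus(1)[OF X Y] p])
    fix k and v :: "'f vec"
    assume v: "v \<in> carrier_vec p"
    have bound: "sqnorm ((slice H U k * slice H S k * mat_adjoint (slice H V k) - slice H Y k) *\<^sub>v w)
        \<le> (op_norm (X - Y))\<^sup>2 * sqnorm w" if "w \<in> carrier_vec p" for w
      using slice_le_op_norm[OF qtensors_minus(1)[OF X Y] that, of k]
      by (simp add: qtensors_minus(2)[OF X Y] svdD(5))
    show "sqnorm (slice H (X - multi_rank_trunc H U S V \<rho>) k *\<^sub>v v) \<le> (op_norm (X - Y))\<^sup>2 * sqnorm v"
      unfolding qtensors_minus(2)[OF X trunc(1)] trunc(2) svdD(5)
      by (rule eckart_young[OF slice_carrier[OF svdD(1)] slice_carrier[OF svdD(2)]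
            slice_carrier[OF svdD(3)] qt_unitary_slice(1)[OF unitary(1)] qt_unitary_slice[OF unitary(2)]
            svdD(4) singular_values_antimono[OF svd] slice_carrier[OF Y] ker
            op_norm_nonneg[OF qtensors_minus(1)[OF X Y] p] bound v])
  qed
qed

section \<open>The q-rank truncation and the kernels supplied by the two ranks\<close>

lemma slice_submatrix:
  "slice H (submatrix X I J) k = submatrix (slice H X k) I J" if "X \<in> carrier_mat m p"
proof -
  have "pick I i < m" if "i < card {i. i < m \<and> i \<in> I}" for i
    using that by (rule pick_le)
  moreover have "pick J j < p" if "j < card {j. j < p \<and> j \<in> J}" for j
    using that by (rule pick_le)
  ultimately show ?thesis
    using that by (intro eq_matI) (auto simp: slice_def submatrix_def)
qed

lemma submatrix_qtensors:
  assumes "X \<in> qtensors H m p"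
  shows "submatrix X I J \<in> qtensors H (card {i. i < m \<and> i \<in> I}) (card {j. j < p \<and> j \<in> J})"
proof -
  have "pick I i < m" if "i < card {i. i < m \<and> i \<in> I}" for i
    using that by (rule pick_le)
  moreover have "pick J j < p" if "j < card {j. j < p \<and> j \<in> J}" for j
    using that by (rule pick_le)
  moreover have "dim_row X = m" "dim_col X = p"
    using assms by (auto simp: qtensors_def)
  ultimately show ?thesis
    using qtensors_index[OF assms] by (auto simp: qtensors_def elements_mat_def submatrix_def)
qed

text \<open>Slicing commutes with submatrices, products and adjoints, so both tensors are built from
  the same family of slices.\<close>

lemma q_rank_trunc_eq:
  assumes U: "U \<in> qtensors H m m" and S: "S \<in> qtensors H m p" and V: "V \<in> qtensors H p p"
    and r: "r \<le> min m p"
  shows "q_rank_trunc H U S V r = multi_rank_trunc H U S V (\<lambda>_. r)"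
proof -
  have card: "card {i. i < n \<and> i \<in> {..<r}} = r" if "r \<le> n" for n
  proof -
    have "{i. i < n \<and> i \<in> {..<r}} = {..<r}"
      using that by auto
    then show ?thesis
      by simp
  qed
  let ?U = "submatrix U UNIV {..<r}" and ?S = "submatrix S {..<r} {..<r}"
    and ?V = "submatrix V UNIV {..<r}"
  have U': "?U \<in> qtensors H m r" and S': "?S \<in> qtensors H r r" and V': "?V \<in> qtensors H p r"
    using submatrix_qtensors[OF U, of UNIV "{..<r}"] submatrix_qtensors[OF S, of "{..<r}" "{..<r}"]
      submatrix_qtensors[OF V, of UNIV "{..<r}"] r by (simp_all add: card del: lessThan_iff)
  note US = qt_times_qtensors[OF U' S'] and VA = qt_adjoint_qtensors[OF V']
  have car: "U \<in> carrier_mat m m" "S \<in> carrier_mat m p" "V \<in> carrier_mat p p"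
    using U S V by (simp_all add: qtensors_def)
  have "dim_row (qt_times H ?U ?S) = m" "dim_col (qt_adjoint H ?V) = p"
    using US(1) VA(1) by (auto simp: qtensors_def)
  then show ?thesis
    using car unfolding q_rank_trunc_def multi_rank_trunc_def
    \<comment> \<open>Only the outer product is unfolded into \<open>of_slices\<close>; the inner
      factors are rewritten slicewise.\<close>
    by (subst qt_times_def) (simp add: US(2) VA(2) slice_submatrix)
qed

lemma multi_rank_imp_kernel:
  assumes Y: "Y \<in> qtensors H m p" and "multi_rank H Y k < q" and W: "W \<in> carrier_mat p q"
  shows "\<exists>c\<in>carrier_vec q. c \<noteq> 0\<^sub>v q \<and> (slice H Y k * W) *\<^sub>v c = 0\<^sub>v m"
proof -
  have "dim_row Y = m"
    using Y by (auto simp: qtensors_def)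
  then have "vec_space.rank m (slice H Y k) < q"
    using assms(2) by (simp add: multi_rank_def)
  from rank_less_imp_kernel[OF slice_carrier[OF Y] W this] show ?thesis
    by blast
qed

text \<open>A vanishing singular quasitube makes the corresponding row of \<open>S\<close> zero in
  every slice, so \<open>?S * Z\<close> has at most \<open>n\<close> nonzero rows and, since
  \<open>n < q\<close>, a nonzero kernel vector. Multiplying by \<open>?U\<close> from the left
  keeps it in the kernel.\<close>

lemma q_rank_imp_kernel:
  assumes "has_q_rank H m p Y n" and "n < q" and W: "W \<in> carrier_mat p q"
  shows "\<exists>c\<in>carrier_vec q. c \<noteq> 0\<^sub>v q \<and> (slice H Y k * W) *\<^sub>v c = 0\<^sub>v m"
proof -
  obtain U S V where svd: "q_svd H m p Y U S V"
    and n: "n = card {i. i < min m p \<and> S $$ (i, i) \<noteq> (\<lambda>x. 0)}"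
    using assms(1) unfolding has_q_rank_def by blast
  note svdD = q_svdD[OF svd]
  let ?I = "{i. i < min m p \<and> S $$ (i, i) \<noteq> (\<lambda>x. 0)}"
  let ?U = "slice H U k" and ?S = "slice H S k" and ?V = "mat_adjoint (slice H V k)"
  have U: "?U \<in> carrier_mat m m" and S: "?S \<in> carrier_mat m p" and V: "?V \<in> carrier_mat p p"
    by (auto intro: slice_carrier svdD(1-3) mat_adjoint_carrier)
  define Z where "Z = ?V * W"
  have Z: "Z \<in> carrier_mat p q"
    unfolding Z_def by (rule mult_carrier_mat[OF V W])
  have "row (?S * Z) i = 0\<^sub>v q" if i: "i < m" "i \<notin> ?I" for i
  proof (rule eq_vecI)
    have "S $$ (i, l) = (\<lambda>x. 0) \<or> ?S $$ (i, l) = 0" if "l < p" for l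
      using i that svdD(4)[of k] S by (cases "i = l") (auto simp: diagonal_mat_def)
    then have S0: "?S $$ (i, l) = 0" if "l < p" for l
      using that i(1) S by (fastforce simp: slice_def qt_pi_zero)
    fix j
    assume "j < dim_vec (0\<^sub>v q :: 'f vec)"
    then have "(?S * Z) $$ (i, j) = 0"
      using i(1) by (subst index_mult_mat_sum[OF S Z]) (auto simp: S0)
    then show "row (?S * Z) i $ j = 0\<^sub>v q $ j"
      using i(1) S Z \<open>j < dim_vec (0\<^sub>v q)\<close> by simp
  qed (use Z in simp)
  then obtain c where c: "c \<in> carrier_vec q" "c \<noteq> 0\<^sub>v q" "(?S * Z) *\<^sub>v c = 0\<^sub>v m"
    using few_rows_imp_kernel[of "?S * Z" m q ?I] S Z n assms(2) by auto
  have "(slice H Y k * W) *\<^sub>v c = ?U *\<^sub>v ((?S * Z) *\<^sub>v c)"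
    unfolding svdD(5) Z_def
    by (simp add: mult_mat_mat_vec carrier_matD[OF U] carrier_matD[OF S]
        carrier_matD[OF slice_carrier[OF svdD(3)]] carrier_matD[OF W] carrier_vecD[OF c(1)])
  also have "\<dots> = 0\<^sub>v m"
    unfolding c(3) using U by auto
  finally show ?thesis
    using c(1,2) by blast
qed

end

theorem theorem5p11:
  fixes H :: "('f::rc_scalar, 'h::banach) based_space"
    and m p r :: nat
    and \<rho> :: "int \<Rightarrow> nat"
    and X Y U S V :: "('h \<Rightarrow> 'h) mat"
  assumes "based_hilbert_space H"
    and "0 < m" and "0 < p"
    and "X \<in> qtensors H m p"
    and "q_svd H m p X U S V"
    and "r \<le> min m p"
    and "\<And>k. \<rho> k \<le> min m p"
    and "Y \<in> qtensors H m p"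
  shows "((\<forall>k. multi_rank H Y k \<le> \<rho> k) \<longrightarrow>
           op_norm (X - multi_rank_trunc H U S V \<rho>) \<le> op_norm (X - Y)) \<and>
         (\<forall>n. has_q_rank H m p Y n \<and> n \<le> r \<longrightarrow>
           op_norm (X - q_rank_trunc H U S V r) \<le> op_norm (X - Y))"
proof -
  interpret based_hilbert_space H
    by fact
  show ?thesis
  proof (intro conjI allI impI)
    assume "\<forall>k. multi_rank H Y k \<le> \<rho> k"
    then show "op_norm (X - multi_rank_trunc H U S V \<rho>) \<le> op_norm (X - Y)"
      \<comment> \<open>Rank at most \<open>\<rho> k\<close> means less than
        \<open>Suc (\<rho> k)\<close>, the number of columns in the kernel condition.\<close>
      by (intro op_norm_multi_rank_trunc_le[OF assms(3-5,7,8)] multi_rank_imp_kernel[OF assms(8)])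
        (auto simp: less_Suc_eq_le)
  next
    fix n
    assume "has_q_rank H m p Y n \<and> n \<le> r"
    then show "op_norm (X - q_rank_trunc H U S V r) \<le> op_norm (X - Y)"
      \<comment> \<open>The claim becomes the one for the constant multi-rank \<open>r\<close>; the
        q-SVD of \<open>Y\<close> supplies the kernel condition because
        \<open>n < Suc r\<close>.\<close>
      unfolding q_rank_trunc_eq[OF q_svdD(1-3)[OF assms(5)] assms(6)]
      by (intro op_norm_multi_rank_trunc_le[OF assms(3-5) _ assms(8)] q_rank_imp_kernel[of m p Y n])
        (use assms(6) in \<open>auto simp: less_Suc_eq_le\<close>)
  qed
qed

end
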